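(* Let $m$ be a positive integer, $1<p_1,\dots,p_m<\infty$. Suppose that $0\le\alpha<mn$, $\frac1p=\frac1{p_1}+\cdots+\frac1{p_m}$ and $p\le q<\infty$. Let $\omega_1,\dots,\omega_m$ and $v$ be weights on $\mathbb R^n$ and put $\sigma_i=\omega_i^{1-p_i'}$, $i=1,\dots,m$. Suppose that the weights $\sigma_i$, $i=1,\dots,m$, are in the class $\mathcal A_\infty$ and define $$[\vec\omega,v]_{S_{\vec P,q}}=\sup_{Q}\frac{\left(\int_Q\left(\mathcal M_\alpha(\sigma_1\chi_Q,\dots,\sigma_m\chi_Q)(x)\right)^q v(x)\,dx\right)^{1/q}}{\prod_{i=1}^m\sigma_i(Q)^{1/p_i}},$$ the supremum being over all cubes $Q\subset\mathbb R^n$. Then $\mathcal M_\alpha$ is bounded from $L^{p_1}(\omega_1)\times\cdots\times L^{p_m}(\omega_m)$ to $L^q(v)$ if and only if $[\vec\omega,v]_{S_{\vec P,q}}$ is finite. Moreover, $$\|\mathcal M_\alpha\|_{\left(\prod_{i=1}^m L^{p_i}(\omega_i)\right)\to L^q(v)}\simeq[\vec\omega,v]_{S_{\vec P,q}}.$$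
   Context: Cubes in $\mathbb R^n$ are non-degenerate with sides parallel to the coordinate axes; $|Q|$ is the Lebesgue measure of $Q$. A weight is a locally integrable function on $\mathbb R^n$ that is positive almost everywhere. For a weight $\omega$, $\omega(Q)=\int_Q\omega(x)\,dx$, and $L^p(\omega)$ is the space of measurable $f$ with $\int_{\mathbb R^n}|f|^p\omega\,dx<\infty$. $p_i'$ is the conjugate exponent of $p_i$. The class $\mathcal A_\infty$ consists of the weights $\omega$ satisfying $$[\omega]_{\mathcal A_\infty}:=\sup_{Q}\left(\frac1{|Q|}\int_Q\omega\right)\exp\left(\frac1{|Q|}\int_Q\log\omega^{-1}\right)<\infty,$$ the supremum over all cubes $Q$. The multilinear fractional maximal function is, for $\vec f=(f_1,\dots,f_m)$ with measurable entries, $$\mathcal M_\alpha\vec f(x)=\sup_Q|Q|^{\alpha/n}\prod_{i=1}^m\frac{\chi_Q(x)}{|Q|}\int_Q|f_i(y)|\,dy,$$ the supremum over all cubes $Q$. The norm of $\mathcal M_\alpha$ is the least constant $K$ (possibly $\infty$) with $\|\mathcal M_\alpha\vec f\|_{L^q(v)}\le K\prod_{i=1}^m\|f_i\|_{L^{p_i}(\omega_i)}$ for all $\vec f$. For two positive quantities, $A\lesssim B$ means that there is a universal constant $C>0$ such that $A\le CB$; $A\simeq B$ means $A\lesssim B$ and $B\lesssim A$.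
   Formalization: The implicit constant in the bound of the norm of M_α by [ω,v]_S may depend on m, n, α, p_i, q and on an upper bound for the A_∞ constants of the σ_i; a constant independent of the weights is impossible in general (e.g. n=1, m=2, α=0, p_i=2, q=1). *)

theory Defs
  imports "HOL-Analysis.Analysis"
begin

text \<open>
  Euclidean space is \<open>real ^ 'n\<close>, with dimension \<open>CARD('n)\<close>, carrying Lebesgue measure on the
  Lebesgue sigma-algebra (\<open>lebesgue\<close>). Quantities that may be infinite live in \<open>ennreal\<close>, with the
  usual convention that zero times infinity is zero.
\<close>

subsection \<open>Cubes and weights\<close>

definition cubes :: "(real ^ 'n) set set" where
  "cubes = {cbox a (a + (\<chi> i. l)) | a l. 0 < l}"

definition locally_integrable :: "(real ^ 'n \<Rightarrow> real) \<Rightarrow> bool" where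
  "locally_integrable f \<longleftrightarrow> f \<in> borel_measurable lebesgue \<and>
     (\<forall>K. compact K \<longrightarrow> set_integrable lebesgue K f)"

definition weight :: "(real ^ 'n \<Rightarrow> real) \<Rightarrow> bool" where
  "weight w \<longleftrightarrow> locally_integrable w \<and> (AE x in lebesgue. 0 < w x)"

definition weight_mass :: "(real ^ 'n \<Rightarrow> real) \<Rightarrow> (real ^ 'n) set \<Rightarrow> ennreal" where
  "weight_mass w Q = (\<integral>\<^sup>+x\<in>Q. ennreal (w x) \<partial>lebesgue)"

definition conj_exponent :: "real \<Rightarrow> real" where
  "conj_exponent p = p / (p - 1)"

definition dual_weight :: "real \<Rightarrow> (real ^ 'n \<Rightarrow> real) \<Rightarrow> real ^ 'n \<Rightarrow> real" where
  "dual_weight p w = (\<lambda>x. w x powr (1 - conj_exponent p))"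

text \<open>
  For a weight \<open>w\<close> the positive part of \<open>ln w\<close> is bounded by \<open>w\<close>, hence integrable over every cube.
  So the integral of \<open>ln (inverse w)\<close> over a cube always exists in the extended sense, and if that
  function is not Bochner integrable then its integral, and so its exponential mean, is infinite.
  (A Bochner integral on its own would return 0 in that case.)
\<close>

definition exp_log_mean :: "(real ^ 'n \<Rightarrow> real) \<Rightarrow> (real ^ 'n) set \<Rightarrow> ennreal" where
  "exp_log_mean w Q =
     (if set_integrable lebesgue Q (\<lambda>x. ln (inverse (w x)))
      then ennreal (exp ((LINT x:Q|lebesgue. ln (inverse (w x))) / measure lebesgue Q))
      else \<infinity>)"

definition A_infty_const :: "(real ^ 'n \<Rightarrow> real) \<Rightarrow> ennreal" where
  "A_infty_const w =
     (SUP Q\<in>cubes. weight_mass w Q / emeasure lebesgue Q * exp_log_mean w Q)"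

definition A_infty :: "(real ^ 'n \<Rightarrow> real) set" where
  "A_infty = {w. weight w \<and> A_infty_const w < \<infinity>}"

subsection \<open>Weighted Lebesgue spaces\<close>

text \<open>Real powers of extended nonnegative reals, meant for positive exponents only.\<close>

definition epowr :: "ennreal \<Rightarrow> real \<Rightarrow> ennreal" where
  "epowr x r = (if x = \<infinity> then \<infinity> else ennreal (enn2real x powr r))"

definition wnorm :: "real \<Rightarrow> (real ^ 'n \<Rightarrow> real) \<Rightarrow> (real ^ 'n \<Rightarrow> ennreal) \<Rightarrow> ennreal" where
  "wnorm p w g = epowr (\<integral>\<^sup>+x. epowr (g x) p * ennreal (w x) \<partial>lebesgue) (1 / p)"

definition Lp_space :: "real \<Rightarrow> (real ^ 'n \<Rightarrow> real) \<Rightarrow> (real ^ 'n \<Rightarrow> real) set" where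
  "Lp_space p w = {f \<in> borel_measurable lebesgue.
     (\<integral>\<^sup>+x. ennreal (\<bar>f x\<bar> powr p) * ennreal (w x) \<partial>lebesgue) < \<infinity>}"

definition Lp_norm :: "real \<Rightarrow> (real ^ 'n \<Rightarrow> real) \<Rightarrow> (real ^ 'n \<Rightarrow> real) \<Rightarrow> ennreal" where
  "Lp_norm p w f = wnorm p w (\<lambda>x. ennreal \<bar>f x\<bar>)"

subsection \<open>The multilinear fractional maximal function\<close>

text \<open>Families of \<open>m\<close> objects are functions on \<open>nat\<close> of which only the values on \<open>{1..m}\<close> matter.\<close>

definition max_op ::
    "nat \<Rightarrow> real \<Rightarrow> (nat \<Rightarrow> real ^ 'n \<Rightarrow> real) \<Rightarrow> real ^ 'n \<Rightarrow> ennreal" where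
  "max_op m \<alpha> f x =
     (SUP Q\<in>cubes. ennreal (measure lebesgue Q powr (\<alpha> / real CARD('n))) *
        (\<Prod>i\<in>{1..m}. indicator Q x / emeasure lebesgue Q *
           (\<integral>\<^sup>+y\<in>Q. ennreal \<bar>f i y\<bar> \<partial>lebesgue)))"

definition max_op_bound ::
    "nat \<Rightarrow> real \<Rightarrow> (nat \<Rightarrow> real) \<Rightarrow> real \<Rightarrow> (nat \<Rightarrow> real ^ 'n \<Rightarrow> real) \<Rightarrow> (real ^ 'n \<Rightarrow> real)
      \<Rightarrow> ennreal \<Rightarrow> bool" where
  "max_op_bound m \<alpha> p q \<omega> v K \<longleftrightarrow>
     (\<forall>f. (\<forall>i\<in>{1..m}. f i \<in> Lp_space (p i) (\<omega> i)) \<longrightarrow>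
        wnorm q v (max_op m \<alpha> f) \<le> K * (\<Prod>i\<in>{1..m}. Lp_norm (p i) (\<omega> i) (f i)))"

definition max_op_bounded ::
    "nat \<Rightarrow> real \<Rightarrow> (nat \<Rightarrow> real) \<Rightarrow> real \<Rightarrow> (nat \<Rightarrow> real ^ 'n \<Rightarrow> real) \<Rightarrow> (real ^ 'n \<Rightarrow> real)
      \<Rightarrow> bool" where
  "max_op_bounded m \<alpha> p q \<omega> v \<longleftrightarrow> (\<exists>K<\<infinity>. max_op_bound m \<alpha> p q \<omega> v K)"

definition max_op_norm ::
    "nat \<Rightarrow> real \<Rightarrow> (nat \<Rightarrow> real) \<Rightarrow> real \<Rightarrow> (nat \<Rightarrow> real ^ 'n \<Rightarrow> real) \<Rightarrow> (real ^ 'n \<Rightarrow> real)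
      \<Rightarrow> ennreal" where
  "max_op_norm m \<alpha> p q \<omega> v = Inf {K. max_op_bound m \<alpha> p q \<omega> v K}"

definition S_const ::
    "nat \<Rightarrow> real \<Rightarrow> (nat \<Rightarrow> real) \<Rightarrow> real \<Rightarrow> (nat \<Rightarrow> real ^ 'n \<Rightarrow> real) \<Rightarrow> (real ^ 'n \<Rightarrow> real)
      \<Rightarrow> ennreal" where
  "S_const m \<alpha> p q \<omega> v =
     (let \<sigma> = (\<lambda>i. dual_weight (p i) (\<omega> i)) in
      SUP Q\<in>cubes.
        epowr (\<integral>\<^sup>+x\<in>Q. epowr (max_op m \<alpha> (\<lambda>i y. \<sigma> i y * indicator Q y) x) q * ennreal (v x)
                 \<partial>lebesgue) (1 / q)
        / (\<Prod>i\<in>{1..m}. epowr (weight_mass (\<sigma> i) Q) (1 / p i)))"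

end

(* Covering cubes by cells of the finitely many 4-adic grids translated by a third of the side length,
   and passing to a monotone limit, reduces M_alpha to maxima over finite laminar families of
   cubes Q. Partitioning according to the cube at which the maximum is attained gives disjoint E_Q
   inside Q with integral (max)^q v = sum_Q g_Q b_Q^(q/p). With f_i = h_i sigma_i, b_Q is the p-th power of
   the product of the sigma_i-averages of the h_i, and the testing condition says that the g_Q with Q
   inside R add up to at most S^q prod_i sigma_i(R)^(q/p_i). The A_infinity hypothesis enters once: by
   Jensen, prod_i sigma_i(R)^(p/p_i) is at most a constant times nu(R) for
   nu = prod_i sigma_i^(p/p_i). So the g_Q satisfy a Carleson condition of exponent q/p with respect to
   nu, the Carleson embedding bounds the sum by (integral of max_Q b_Q d nu)^(q/p), and this is
   controlled by Hoelder and the dyadic maximal theorem for each sigma_i. *)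

theory Submission
  imports Defs
begin

text \<open>The bound supplied by the testing condition is a power of prod_i sigma_i(R)^(p/p_i),
  which is not additive in R, whereas a Carleson embedding needs a measure: the values on disjoint
  maximal sets must add up, and Chebyshev must control superlevel sets. Hoelder always gives nu(R)
  <= prod_i sigma_i(R)^(p/p_i); it is the reverse estimate that costs the A_infinity constant. The
  choice of nu is dictated by the final Hoelder step: if A_i majorises the sigma_i-averages of h_i,
  then (prod_i A_i)^p nu = prod_i (A_i^p_i sigma_i)^(p/p_i), with exponents adding up to 1. The
  estimates instead compare sums over superlevel sets, and p <= q enters as superadditivity of
  t^(q/p) over disjoint maximal sets. Finite families guarantee that maximal sets exist and that the
  quantity absorbed in the maximal theorem is finite.\<close>

section \<open>Maximal and embedding inequalities for finite laminar families\<close>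

text \<open>A discrete layer-cake formula: \<open>\<Phi> (a Q)\<close> telescopes over the values of
  \<open>a\<close> below it, so each increment of \<open>\<Phi>\<close> is multiplied by the sum of
  \<open>c\<close> over a superlevel set. On that set \<open>w t\<close> converts \<open>c\<close>
  into \<open>d\<close> and increments of \<open>\<Phi>\<close> into increments of
  \<open>\<Psi>\<close>. It serves both the maximal inequality and the Carleson embedding.\<close>

lemma sum_le_sum_of_level_sums:
  fixes a c d :: "'a \<Rightarrow> real" and w \<Phi> \<Psi> :: "real \<Rightarrow> real"
  assumes "finite F" and a: "\<And>Q. Q \<in> F \<Longrightarrow> 0 \<le> a Q" and c: "\<And>Q. Q \<in> F \<Longrightarrow> 0 \<le> c Q"
    and level: "\<And>t. t \<in> a ` F \<Longrightarrow> w t * (\<Sum>Q\<in>{Q\<in>F. t \<le> a Q}. c Q) \<le> (\<Sum>Q\<in>{Q\<in>F. t \<le> a Q}. d Q)"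
    and step: "\<And>r t. 0 \<le> r \<Longrightarrow> r \<le> t \<Longrightarrow> \<Phi> t - \<Phi> r \<le> w t * (\<Psi> t - \<Psi> r)"
    and mono: "\<And>r t. 0 \<le> r \<Longrightarrow> r \<le> t \<Longrightarrow> \<Psi> r \<le> \<Psi> t"
    and zero: "\<Phi> 0 = 0" "\<Psi> 0 = 0"
  shows "(\<Sum>Q\<in>F. c Q * \<Phi> (a Q)) \<le> (\<Sum>Q\<in>F. d Q * \<Psi> (a Q))"
proof -
  \<comment> \<open>The base level \<open>t0\<close> is general so that the induction can discard
    the lowest value \<open>t1\<close> and restart there.\<close>
  have shifted: "(\<Sum>Q\<in>F. c Q * (\<Phi> (a Q) - \<Phi> t0)) \<le> (\<Sum>Q\<in>F. d Q * (\<Psi> (a Q) - \<Psi> t0))"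
    if "\<And>Q. Q \<in> F \<Longrightarrow> t0 \<le> a Q" "0 \<le> t0" for t0
    using \<open>finite F\<close> a c level that
  proof (induction F arbitrary: t0 rule: finite_psubset_induct)
    case (psubset F)
    show ?case
    proof (cases "F = {}")
      case False
      define t1 where "t1 = Min (a ` F)"
      define F' where "F' = {Q\<in>F. t1 < a Q}"
      have t1: "t1 \<in> a ` F" "\<And>Q. Q \<in> F \<Longrightarrow> t1 \<le> a Q"
        using False psubset.hyps by (auto simp: t1_def)
      then have t01: "t0 \<le> t1" "0 \<le> t1" using psubset.prems(4,5) by fastforce+
      have "F' \<subset> F" using t1 by (auto simp: F'_def)
      have fin: "finite F" "finite F'" using psubset.hyps by (auto simp: F'_def)
      have sub: "{Q\<in>F'. t \<le> a Q} = {Q\<in>F. t \<le> a Q}" if "t \<in> a ` F'" for t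
        using that by (auto simp: F'_def)
      have IH: "(\<Sum>Q\<in>F'. c Q * (\<Phi> (a Q) - \<Phi> t1)) \<le> (\<Sum>Q\<in>F'. d Q * (\<Psi> (a Q) - \<Psi> t1))"
      proof (rule psubset.IH[OF \<open>F' \<subset> F\<close>])
        fix t assume "t \<in> a ` F'"
        then show "w t * (\<Sum>Q\<in>{Q\<in>F'. t \<le> a Q}. c Q) \<le> (\<Sum>Q\<in>{Q\<in>F'. t \<le> a Q}. d Q)"
          using psubset.prems(3)[of t] sub by (auto simp: F'_def)
      qed (use psubset.prems t01 in \<open>auto simp: F'_def\<close>)
      have sumF': "(\<Sum>Q\<in>F'. e Q * (X (a Q) - X t1)) = (\<Sum>Q\<in>F. e Q * (X (a Q) - X t1))"
        for e :: "'a \<Rightarrow> real" and X :: "real \<Rightarrow> real"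
        using t1(2) fin by (intro sum.mono_neutral_left) (auto simp: F'_def order.strict_iff_order)
      \<comment> \<open>Indices with \<open>a Q = t1\<close> vanish from the sum shifted to
        \<open>t1\<close>, so \<open>F\<close> and \<open>F'\<close> give the same shifted sum; the
        step from \<open>t0\<close> to \<open>t1\<close> carries the full weight of
        \<open>F\<close>.\<close>
      have cF: "(\<Sum>Q\<in>F. c Q * (\<Phi> (a Q) - \<Phi> t0))
          = (\<Sum>Q\<in>F'. c Q * (\<Phi> (a Q) - \<Phi> t1)) + sum c F * (\<Phi> t1 - \<Phi> t0)"
        unfolding sumF' by (simp add: sum_distrib_left sum_subtractf sum.distrib algebra_simps)
      have "sum c F * (\<Phi> t1 - \<Phi> t0) \<le> sum c F * (w t1 * (\<Psi> t1 - \<Psi> t0))"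
        using psubset.prems t01 by (intro mult_left_mono step sum_nonneg) auto
      also have "\<dots> = (w t1 * sum c F) * (\<Psi> t1 - \<Psi> t0)" by simp
      also have "\<dots> \<le> sum d F * (\<Psi> t1 - \<Psi> t0)"
      proof (rule mult_right_mono)
        have "{Q\<in>F. t1 \<le> a Q} = F" using t1 by auto
        then show "w t1 * sum c F \<le> sum d F" using psubset.prems(3)[OF t1(1)] by simp
        show "0 \<le> \<Psi> t1 - \<Psi> t0" using mono[of t0 t1] psubset.prems t01 by simp
      qed
      finally have "(\<Sum>Q\<in>F. c Q * (\<Phi> (a Q) - \<Phi> t0))
          \<le> (\<Sum>Q\<in>F'. d Q * (\<Psi> (a Q) - \<Psi> t1)) + sum d F * (\<Psi> t1 - \<Psi> t0)"
        using IH cF by linarith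
      also have "\<dots> = (\<Sum>Q\<in>F. d Q * (\<Psi> (a Q) - \<Psi> t0))"
        unfolding sumF' by (simp add: sum_distrib_left sum_subtractf sum.distrib algebra_simps)
      finally show ?thesis .
    qed simp
  qed
  show ?thesis using shifted[of 0] a zero by simp
qed

text \<open>The graph of y^s lies above its tangent at x, written without division so that s = 1 and
  x = 0 are covered.\<close>

lemma powr_Young:
  fixes x y s :: real
  assumes "1 \<le> s" "0 \<le> x" "0 \<le> y"
  shows "s * x powr (s - 1) * y \<le> (s - 1) * x powr s + y powr s"
proof (cases "s = 1 \<or> x = 0")
  case True
  then show ?thesis using assms by auto
next
  case False
  then have "1 < s" "0 < x" using assms by auto
  define s' where "s' = s / (s - 1)"
  have "y * x powr (s - 1) \<le> y powr s / s + (x powr (s - 1)) powr s' / s'"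
    using \<open>1 < s\<close> assms by (intro Youngs_inequality) (auto simp: s'_def field_simps)
  then have "s * (y * x powr (s - 1)) \<le> s * (y powr s / s + (x powr (s - 1)) powr s' / s')"
    using \<open>1 < s\<close> by (intro mult_left_mono) auto
  also have "(x powr (s - 1)) powr s' = x powr s"
    using \<open>1 < s\<close> by (simp add: powr_powr s'_def)
  also have "s * (y powr s / s + x powr s / s') = (s - 1) * x powr s + y powr s"
    using \<open>1 < s\<close> by (simp add: s'_def field_simps)
  finally show ?thesis by (simp add: mult_ac)
qed

text \<open>Linearises a maximum: by disjointness the \<open>R\<close> with
  \<open>x \<in> E R\<close> is unique, hence it maximises \<open>a\<close> among all
  \<open>Q\<close> with \<open>x \<in> H Q\<close>. A maximal function thus becomes a finite sum of
  multiples of indicators.\<close>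

lemma disjoint_selection:
  fixes a :: "'i \<Rightarrow> real" and H :: "'i \<Rightarrow> 'b set"
  assumes "finite F" "\<And>Q. Q \<in> F \<Longrightarrow> H Q \<in> sets M"
  obtains E where "\<And>Q. Q \<in> F \<Longrightarrow> E Q \<in> sets M" "\<And>Q. Q \<in> F \<Longrightarrow> E Q \<subseteq> H Q"
    "disjoint_family_on E F"
    "\<And>Q x. Q \<in> F \<Longrightarrow> x \<in> H Q \<Longrightarrow> \<exists>R\<in>F. x \<in> E R \<and> a Q \<le> a R"
proof -
  have "\<exists>E. (\<forall>Q\<in>F. E Q \<in> sets M \<and> E Q \<subseteq> H Q) \<and> disjoint_family_on E F \<and>
     (\<forall>Q\<in>F. \<forall>x\<in>H Q. \<exists>R\<in>F. x \<in> E R \<and> a Q \<le> a R)"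
    using assms
  proof (induction F rule: finite_induct)
    case empty
    then show ?case by (auto simp: disjoint_family_on_def)
  next
    case (insert P F)
    from insert obtain E where E: "\<forall>Q\<in>F. E Q \<in> sets M \<and> E Q \<subseteq> H Q" "disjoint_family_on E F"
      "\<forall>Q\<in>F. \<forall>x\<in>H Q. \<exists>R\<in>F. x \<in> E R \<and> a Q \<le> a R" by auto
    \<comment> \<open>The new index \<open>P\<close> claims only the points where it strictly beats
      every earlier competitor; ties stay with the earlier owner.\<close>
    define D where "D = H P - (\<Union>Q\<in>{Q\<in>F. a P \<le> a Q}. H Q)"
    define E' where "E' Q = (if Q = P then D else E Q - D)" for Q
    have D: "D \<in> sets M" unfolding D_def using insert.hyps insert.prems
      by (intro sets.Diff sets.finite_UN) auto
    have E': "E' P = D" "\<And>Q. Q \<in> F \<Longrightarrow> E' Q = E Q - D" using insert.hyps by (auto simp: E'_def)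
    have 1: "\<forall>Q\<in>insert P F. E' Q \<in> sets M \<and> E' Q \<subseteq> H Q"
      using E(1) D E' by (auto simp: D_def)
    have 2: "disjoint_family_on E' (insert P F)"
    proof (unfold disjoint_family_on_def, intro ballI impI)
      fix Q R assume "Q \<in> insert P F" "R \<in> insert P F" "Q \<noteq> R"
      then consider "Q = P" "R \<in> F" | "R = P" "Q \<in> F" | "Q \<in> F" "R \<in> F" by auto
      then show "E' Q \<inter> E' R = {}"
      proof cases
        case 3
        then have "E Q \<inter> E R = {}" using E(2) \<open>Q \<noteq> R\<close> by (auto simp: disjoint_family_on_def)
        with 3 show ?thesis by (auto simp: E')
      qed (auto simp: E')
    qed
    have 3: "\<exists>R\<in>insert P F. x \<in> E' R \<and> a Q \<le> a R" if QF: "Q \<in> insert P F" and xQ: "x \<in> H Q" for Q x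
    proof (cases "x \<in> D")
      case True
      have "a Q \<le> a P"
      proof (rule ccontr)
        assume "\<not> a Q \<le> a P"
        with that have "Q \<in> F" "a P \<le> a Q" by auto
        with that True show False unfolding D_def by blast
      qed
      with True show ?thesis by (auto simp: E')
    next
      case False
      show ?thesis
      proof (cases "Q = P")
        case True
        with False that obtain Q' where "Q' \<in> F" "a P \<le> a Q'" "x \<in> H Q'" by (auto simp: D_def)
        then obtain R where "R \<in> F" "x \<in> E R" "a Q' \<le> a R" using E(3) by blast
        with False True \<open>a P \<le> a Q'\<close> show ?thesis by (intro bexI[of _ R]) (auto simp: E')
      next
        case False': False
        then have "Q \<in> F" using QF by simp
        then obtain R where "R \<in> F" "x \<in> E R" "a Q \<le> a R" using E(3) xQ by meson
        with False show ?thesis by (intro bexI[of _ R]) (auto simp: E')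
      qed
    qed
    from 1 2 3 show ?case by blast
  qed
  then obtain E where "\<forall>Q\<in>F. E Q \<in> sets M \<and> E Q \<subseteq> H Q" "disjoint_family_on E F"
     "\<forall>Q\<in>F. \<forall>x\<in>H Q. \<exists>R\<in>F. x \<in> E R \<and> a Q \<le> a R" by blast
  then show ?thesis by (intro that[of E]) simp_all
qed

section \<open>Laminar families and the maximal theorem\<close>

definition laminar_on :: "('i \<Rightarrow> 'b set) \<Rightarrow> 'i set \<Rightarrow> bool" where
  "laminar_on H F \<longleftrightarrow> (\<forall>Q\<in>F. \<forall>R\<in>F. H Q \<inter> H R = {} \<or> H Q \<subseteq> H R \<or> H R \<subseteq> H Q)"

lemma laminar_on_subset: "laminar_on H F \<Longrightarrow> G \<subseteq> F \<Longrightarrow> laminar_on H G"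
  unfolding laminar_on_def by blast

text \<open>A newcomer not contained in a selected set swallows every selected set it meets, by
  laminarity. \<open>H\<close> may repeat a set under several indices; only one of them is kept, so
  that \<open>G\<close> is disjoint as an indexed family.\<close>

lemma laminar_maximal:
  assumes "finite F" "laminar_on H F"
  obtains G where "G \<subseteq> F" "disjoint_family_on H G" "\<And>Q. Q \<in> F \<Longrightarrow> \<exists>R\<in>G. H Q \<subseteq> H R"
proof -
  have "\<exists>G\<subseteq>F. disjoint_family_on H G \<and> (\<forall>Q\<in>F. \<exists>R\<in>G. H Q \<subseteq> H R)"
    using assms
  proof (induction F rule: finite_induct)
    case empty
    then show ?case by (auto simp: disjoint_family_on_def)
  next
    case (insert P F)
    have lam: "laminar_on H F" using insert.prems by (rule laminar_on_subset) auto
    from insert.IH[OF this] obtain G where G: "G \<subseteq> F" "disjoint_family_on H G"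
      "\<forall>Q\<in>F. \<exists>R\<in>G. H Q \<subseteq> H R" by auto
    show ?case
    proof (cases "\<exists>R\<in>G. H P \<subseteq> H R")
      case True
      with G show ?thesis by (intro exI[of _ G]) auto
    next
      case False
      define G' where "G' = insert P {R\<in>G. H R \<inter> H P = {}}"
      have "H R \<subseteq> H P" if "R \<in> G" "H R \<inter> H P \<noteq> {}" for R
        using insert.prems that G(1) False unfolding laminar_on_def by blast
      then have "\<forall>Q\<in>insert P F. \<exists>R\<in>G'. H Q \<subseteq> H R"
        using G(3) unfolding G'_def by fastforce
      moreover have "disjoint_family_on H G'"
        using G(2) unfolding G'_def disjoint_family_on_def by blast
      ultimately show ?thesis using G(1) by (intro exI[of _ G']) (auto simp: G'_def)
    qed
  qed
  then show ?thesis using that by auto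
qed

text \<open>t^s is the integral of u^(s-1) d(s u), and the increasing factor u^(s-1) is largest at
  the right end. This is the \<open>step\<close> hypothesis for the Carleson embedding.\<close>

lemma powr_diff_le:
  fixes r t s :: real
  assumes "1 \<le> s" "0 \<le> r" "r \<le> t"
  shows "t powr s - r powr s \<le> t powr (s - 1) * (s * t - s * r)"
proof -
  have "t powr s = t powr (s - 1) * t" using assms by (cases "t = 0") (auto simp: powr_mult_base mult.commute)
  then show ?thesis using powr_Young[of s t r] assms by (simp add: algebra_simps)
qed

text \<open>The same for t^p as the integral of u d(p/(p-1) u^(p-1)), now with weight u: the
  \<open>step\<close> hypothesis for the maximal inequality, where the weak-type bound carries one
  factor t.\<close>

lemma powr_diff_le':
  fixes r t p :: real
  assumes "1 < p" "0 \<le> r" "r \<le> t"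
  shows "t powr p - r powr p \<le> t * (p / (p - 1) * t powr (p - 1) - p / (p - 1) * r powr (p - 1))"
proof -
  have e: "t powr p = t powr (p - 1) * t" using assms by (cases "t = 0") (auto simp: powr_mult_base mult.commute)
  have "(p - 1) * (t powr p - r powr p) \<le> t * (p * t powr (p - 1) - p * r powr (p - 1))"
    using powr_Young[of p r t] assms by (simp add: algebra_simps e)
  then have "t powr p - r powr p \<le> t * (p * t powr (p - 1) - p * r powr (p - 1)) / (p - 1)"
    using assms by (simp add: pos_le_divide_eq mult.commute)
  also have "\<dots> = t * (p / (p - 1) * t powr (p - 1) - p / (p - 1) * r powr (p - 1))"
    by (simp add: right_diff_distrib diff_divide_distrib)
  finally show ?thesis .
qed

lemma nn_integral_UN_finite:
  assumes "finite F" "disjoint_family_on E F" "\<And>i. i \<in> F \<Longrightarrow> E i \<in> sets M" "f \<in> borel_measurable M"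
  shows "(\<integral>\<^sup>+x\<in>(\<Union>i\<in>F. E i). f x \<partial>M) = (\<Sum>i\<in>F. (\<integral>\<^sup>+x\<in>E i. f x \<partial>M))"
proof -
  have "(\<integral>\<^sup>+x\<in>(\<Union>i\<in>F. E i). f x \<partial>M) = (\<integral>\<^sup>+x. (\<Sum>i\<in>F. f x * indicator (E i) x) \<partial>M)"
    using assms(1,2) by (simp add: indicator_UN_disjoint sum_distrib_left)
  also have "\<dots> = (\<Sum>i\<in>F. (\<integral>\<^sup>+x\<in>E i. f x \<partial>M))"
    using assms by (intro nn_integral_sum) auto
  finally show ?thesis .
qed

lemma sum_indicator_disjoint:
  fixes c :: "'a \<Rightarrow> 'b::semiring_1"
  assumes "finite F" "disjoint_family_on E F" "Q \<in> F" "x \<in> E Q"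
  shows "(\<Sum>R\<in>F. c R * indicator (E R) x) = c Q"
proof -
  have "indicator (E R) x = (if R = Q then 1 else 0 :: 'b)" if "R \<in> F" for R
    using assms that unfolding disjoint_family_on_def by (auto simp: indicator_def)
  then have "(\<Sum>R\<in>F. c R * indicator (E R) x) = (\<Sum>R\<in>F. c R * (if R = Q then 1 else 0))"
    by (intro sum.cong) auto
  also have "\<dots> = c Q" using assms by (simp add: if_distrib cong: if_cong)
  finally show ?thesis .
qed

text \<open>Write x^s = x * x^(s-1) and enlarge only the second factor to the total.\<close>

lemma sum_powr_le_powr_sum:
  fixes x :: "'a \<Rightarrow> real"
  assumes "finite F" "1 \<le> s" "\<And>i. i \<in> F \<Longrightarrow> 0 \<le> x i"
  shows "(\<Sum>i\<in>F. x i powr s) \<le> (\<Sum>i\<in>F. x i) powr s"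
proof -
  define X where "X = sum x F"
  have X: "0 \<le> X" "\<And>i. i \<in> F \<Longrightarrow> x i \<le> X"
    using assms by (auto simp: X_def intro: sum_nonneg member_le_sum)
  have e: "y powr s = y * y powr (s - 1)" if "0 \<le> y" for y :: real
    using that by (cases "y = 0") (auto simp: powr_mult_base)
  have "(\<Sum>i\<in>F. x i powr s) = (\<Sum>i\<in>F. x i * x i powr (s - 1))"
    using assms e by (intro sum.cong) auto
  also have "\<dots> \<le> (\<Sum>i\<in>F. x i * X powr (s - 1))"
    using assms X by (intro sum_mono mult_left_mono powr_mono2) auto
  also have "\<dots> = X powr s" using X by (simp add: e X_def sum_distrib_right)
  finally show ?thesis by (simp add: X_def)
qed

text \<open>Marcinkiewicz interpolation in linearised form: the weak-type bound over the maximal members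
  of a superlevel set feeds the level-sum comparison, and the resulting term is absorbed.\<close>

lemma laminar_maximal_inequality:
  fixes a :: "'i \<Rightarrow> real" and H :: "'i \<Rightarrow> 'b set" and g :: "'b \<Rightarrow> real"
  assumes "finite F" "laminar_on H F" and p: "1 < p"
    and H: "\<And>Q. Q \<in> F \<Longrightarrow> H Q \<in> sets M" "\<And>Q. Q \<in> F \<Longrightarrow> emeasure M (H Q) < \<infinity>"
    and g: "g \<in> borel_measurable M" "\<And>x. 0 \<le> g x"
    and a: "\<And>Q. Q \<in> F \<Longrightarrow> 0 \<le> a Q"
      "\<And>Q. Q \<in> F \<Longrightarrow> ennreal (a Q) * emeasure M (H Q) \<le> (\<integral>\<^sup>+x\<in>H Q. ennreal (g x) \<partial>M)"
  obtains A :: "'b \<Rightarrow> real" where "A \<in> borel_measurable M" "\<And>x. 0 \<le> A x"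
    "\<And>Q x. Q \<in> F \<Longrightarrow> x \<in> H Q \<Longrightarrow> a Q \<le> A x"
    "(\<integral>\<^sup>+x. ennreal (A x powr p) \<partial>M) \<le> ennreal ((2 * p / (p - 1)) powr p * 2) * (\<integral>\<^sup>+x. ennreal (g x powr p) \<partial>M)"
proof -
  obtain E where E: "\<And>Q. Q \<in> F \<Longrightarrow> E Q \<in> sets M" "\<And>Q. Q \<in> F \<Longrightarrow> E Q \<subseteq> H Q"
    "disjoint_family_on E F"
    "\<And>Q x. Q \<in> F \<Longrightarrow> x \<in> H Q \<Longrightarrow> \<exists>R\<in>F. x \<in> E R \<and> a Q \<le> a R"
    using disjoint_selection[of F H M a, OF \<open>finite F\<close> H(1)] by metis
  define A where "A x = (\<Sum>Q\<in>F. a Q * indicator (E Q) x)" for x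
  have A_eq: "A x = a Q" if "Q \<in> F" "x \<in> E Q" for x Q
    using sum_indicator_disjoint[OF \<open>finite F\<close> E(3) that] by (simp add: A_def)
  have A_zero: "A x = 0" if "x \<notin> (\<Union>Q\<in>F. E Q)" for x
    using that unfolding A_def by (intro sum.neutral) auto
  have Am [measurable]: "A \<in> borel_measurable M" using E(1) unfolding A_def by measurable
  have A0: "0 \<le> A x" for x using a(1) unfolding A_def by (auto intro!: sum_nonneg)
  have A_ge: "a Q \<le> A x" if "Q \<in> F" "x \<in> H Q" for Q x
    using E(4)[OF that] A_eq by auto
  note g(1)[measurable]
  let ?K = "(2 * p / (p - 1)) powr p * 2"
  have "(\<integral>\<^sup>+x. ennreal (A x powr p) \<partial>M) \<le> ennreal ?K * (\<integral>\<^sup>+x. ennreal (g x powr p) \<partial>M)"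
  proof (cases "(\<integral>\<^sup>+x. ennreal (g x powr p) \<partial>M) = \<infinity>")
    case True
    \<comment> \<open>Zero times infinity is zero, so a positive constant is what makes the right
      side infinite here.\<close>
    have "ennreal ?K \<noteq> 0" using p by (auto simp: ennreal_eq_0_iff not_le)
    then show ?thesis using True by (simp add: ennreal_mult_top)
  next
    case fin: False
    \<comment> \<open>Finite p-th power integral and finite measure make \<open>g\<close> integrable
      on each \<open>H Q\<close>, by y <= y^p + 1. Hence the coefficients \<open>d Q\<close> below
      are genuine reals.\<close>
    have Hfin: "(\<integral>\<^sup>+x\<in>H Q. ennreal (g x) \<partial>M) < \<infinity>" if "Q \<in> F" for Q
    proof -
      have "g x \<le> g x powr p + 1" for x
      proof (cases "g x \<le> 1")
        case False
        then have "g x powr 1 \<le> g x powr p" using p by (intro powr_mono) auto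
        then show ?thesis using False by simp
      qed (simp add: add_increasing)
      then have "ennreal (g x) \<le> ennreal (g x powr p) + 1" for x
        by (metis ennreal_1 ennreal_leI ennreal_plus powr_ge_zero zero_le_one)
      then have "(\<integral>\<^sup>+x\<in>H Q. ennreal (g x) \<partial>M) \<le> (\<integral>\<^sup>+x. ennreal (g x powr p) + indicator (H Q) x \<partial>M)"
        by (intro nn_integral_mono) (auto simp: indicator_def)
      also have "\<dots> = (\<integral>\<^sup>+x. ennreal (g x powr p) \<partial>M) + emeasure M (H Q)"
        using H(1)[OF that] by (subst nn_integral_add) auto
      also have "\<dots> < \<infinity>" using H(2)[OF that] fin by (simp add: top.not_eq_extremum)
      finally show ?thesis .
    qed
    define c where "c Q = measure M (E Q)" for Q
    define d where "d Q = enn2real (\<integral>\<^sup>+x\<in>E Q. ennreal (g x) \<partial>M)" for Q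
    have Efin: "emeasure M (E Q) = ennreal (c Q)" if "Q \<in> F" for Q
      unfolding c_def using emeasure_mono[OF E(2)[OF that] H(1)[OF that]] H(2)[OF that]
      by (intro emeasure_eq_ennreal_measure) (auto simp: top_unique)
    have dfin: "(\<integral>\<^sup>+x\<in>E Q. ennreal (g x) \<partial>M) = ennreal (d Q)" if "Q \<in> F" for Q
    proof -
      have "(\<integral>\<^sup>+x\<in>E Q. ennreal (g x) \<partial>M) \<le> (\<integral>\<^sup>+x\<in>H Q. ennreal (g x) \<partial>M)"
        using E(2)[OF that] by (intro nn_integral_mono) (auto simp: indicator_def)
      then show ?thesis unfolding d_def using Hfin[OF that]
        by (subst ennreal_enn2real) (auto intro: le_less_trans)
    qed
    have c0: "0 \<le> c Q" and d0: "0 \<le> d Q" for Q by (auto simp: c_def d_def)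
    have int_A: "(\<integral>\<^sup>+x. ennreal (A x powr p) \<partial>M) = ennreal (\<Sum>Q\<in>F. c Q * a Q powr p)"
    proof -
      have "ennreal (A x powr p) = (\<Sum>Q\<in>F. ennreal (a Q powr p) * indicator (E Q) x)" for x
      proof (cases "x \<in> (\<Union>Q\<in>F. E Q)")
        case True
        then obtain Q where Q: "Q \<in> F" "x \<in> E Q" by auto
        show ?thesis by (simp add: A_eq[OF Q] sum_indicator_disjoint[OF \<open>finite F\<close> E(3) Q])
      next
        case False
        then have "(\<Sum>Q\<in>F. ennreal (a Q powr p) * indicator (E Q) x) = 0"
          by (intro sum.neutral) auto
        with A_zero[OF False] show ?thesis by simp
      qed
      then have "(\<integral>\<^sup>+x. ennreal (A x powr p) \<partial>M) = (\<integral>\<^sup>+x. (\<Sum>Q\<in>F. ennreal (a Q powr p) * indicator (E Q) x) \<partial>M)"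
        by simp
      also have "\<dots> = (\<Sum>Q\<in>F. ennreal (a Q powr p) * emeasure M (E Q))"
        using E(1) by (subst nn_integral_sum) (auto simp: nn_integral_cmult_indicator)
      also have "\<dots> = (\<Sum>Q\<in>F. ennreal (c Q * a Q powr p))"
        using Efin c0 by (intro sum.cong) (auto simp: ennreal_mult mult.commute)
      also have "\<dots> = ennreal (\<Sum>Q\<in>F. c Q * a Q powr p)"
        using c0 by (intro sum_ennreal) auto
      finally show ?thesis .
    qed
    \<comment> \<open>The sets \<open>H Q\<close> and the pieces \<open>E Q\<close> with
      \<open>t \<le> a Q\<close> have the same union. The averages are compared on its disjoint
      maximal members, and measure and integral are then redistributed over the pieces.\<close>
    have level: "t * (\<Sum>Q\<in>{Q\<in>F. t \<le> a Q}. c Q) \<le> (\<Sum>Q\<in>{Q\<in>F. t \<le> a Q}. d Q)" if "t \<in> a ` F" for t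
    proof -
      have t0: "0 \<le> t" using that a(1) by auto
      define L where "L = {Q\<in>F. t \<le> a Q}"
      have L: "L \<subseteq> F" "finite L" using \<open>finite F\<close> by (auto simp: L_def)
      have UL: "(\<Union>Q\<in>L. H Q) = (\<Union>Q\<in>L. E Q)"
      proof
        show "(\<Union>Q\<in>L. H Q) \<subseteq> (\<Union>Q\<in>L. E Q)"
          using E(4) unfolding L_def by (fastforce intro: order.trans)
      qed (use E(2) L in blast)
      have disjL: "disjoint_family_on E L" by (rule disjoint_family_on_mono[OF L(1) E(3)])
      obtain G where G: "G \<subseteq> L" "disjoint_family_on H G" "\<And>Q. Q \<in> L \<Longrightarrow> \<exists>R\<in>G. H Q \<subseteq> H R"
        using laminar_maximal[OF L(2) laminar_on_subset[OF \<open>laminar_on H F\<close> L(1)]] by metis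
      have UG: "(\<Union>Q\<in>L. H Q) = (\<Union>Q\<in>G. H Q)" using G by blast
      have finG: "finite G" using G(1) L(2) by (rule finite_subset)
      have "ennreal (t * sum c L) = ennreal t * (\<Sum>Q\<in>L. emeasure M (E Q))"
        using Efin L c0 t0 by (simp add: ennreal_mult sum_nonneg subset_iff flip: sum_ennreal)
      also have "(\<Sum>Q\<in>L. emeasure M (E Q)) = emeasure M (\<Union>Q\<in>L. E Q)"
        using E(1) L disjL by (intro sum_emeasure) auto
      also have "(\<Union>Q\<in>L. E Q) = (\<Union>Q\<in>G. H Q)" using UL UG by simp
      also have "emeasure M (\<Union>Q\<in>G. H Q) = (\<Sum>Q\<in>G. emeasure M (H Q))"
        using H(1) G L finG by (intro sum_emeasure[symmetric]) auto
      also have "ennreal t * \<dots> = (\<Sum>Q\<in>G. ennreal t * emeasure M (H Q))" by (simp add: sum_distrib_left)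
      also have "\<dots> \<le> (\<Sum>Q\<in>G. ennreal (a Q) * emeasure M (H Q))"
        using G(1) by (intro sum_mono mult_right_mono ennreal_leI) (auto simp: L_def)
      also have "\<dots> \<le> (\<Sum>Q\<in>G. (\<integral>\<^sup>+x\<in>H Q. ennreal (g x) \<partial>M))"
        using G(1) L by (intro sum_mono a(2)) auto
      also have "\<dots> = (\<integral>\<^sup>+x\<in>(\<Union>Q\<in>G. H Q). ennreal (g x) \<partial>M)"
        using G L finG H(1) by (intro nn_integral_UN_finite[symmetric]) auto
      also have "\<dots> = (\<integral>\<^sup>+x\<in>(\<Union>Q\<in>L. E Q). ennreal (g x) \<partial>M)" using UL UG by simp
      also have "\<dots> = (\<Sum>Q\<in>L. (\<integral>\<^sup>+x\<in>E Q. ennreal (g x) \<partial>M))"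
        using L E(1) disjL by (intro nn_integral_UN_finite) auto
      also have "\<dots> = ennreal (sum d L)"
        using dfin L d0 by (simp add: subset_iff flip: sum_ennreal)
      finally show ?thesis using d0 by (simp add: L_def sum_nonneg)
    qed
    have main: "(\<Sum>Q\<in>F. c Q * a Q powr p) \<le> (\<Sum>Q\<in>F. d Q * (p / (p - 1) * a Q powr (p - 1)))"
    proof (rule sum_le_sum_of_level_sums[OF \<open>finite F\<close> a(1) c0 level])
      show "t powr p - r powr p \<le> t * (p / (p - 1) * t powr (p - 1) - p / (p - 1) * r powr (p - 1))"
        if "0 \<le> r" "r \<le> t" for r t :: real using powr_diff_le'[OF p that] .
    qed (use p in \<open>auto intro!: divide_right_mono mult_left_mono powr_mono2\<close>)
    \<comment> \<open>Young's inequality with a small coefficient, by cases. With k = p/(p-1),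
      either k z <= y/2 and the left side is at most y^p/2, or y < 2 k z and it is at most (2 k
      z)^p.\<close>
    have point: "p / (p - 1) * y powr (p - 1) * z \<le> y powr p / 2 + (2 * p / (p - 1)) powr p * z powr p"
      if "0 \<le> y" "0 \<le> z" for y z :: real
    proof -
      define k where "k = p / (p - 1)"
      have k: "1 \<le> k" using p by (simp add: k_def)
      have e: "x powr p = x powr (p - 1) * x" if "0 \<le> x" for x :: real
        using that by (cases "x = 0") (auto simp: powr_mult_base mult.commute)
      show ?thesis
      proof (cases "2 * k * z \<le> y")
        case True
        then have "k * y powr (p - 1) * z \<le> y powr (p - 1) * (y / 2)"
          using mult_left_mono[of "k * z" "y / 2" "y powr (p - 1)"] by (simp add: mult_ac)
        also have "\<dots> = y powr p / 2" using e that by simp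
        finally show ?thesis by (simp add: k_def add_increasing2)
      next
        case False
        then have "k * y powr (p - 1) * z \<le> k * (2 * k * z) powr (p - 1) * z"
          using that k p by (intro mult_left_mono mult_right_mono powr_mono2) auto
        also have "\<dots> \<le> (2 * k * z) powr (p - 1) * (2 * k * z)"
          using that k mult_left_mono[of "k * z" "2 * k * z" "(2 * k * z) powr (p - 1)"] by (simp add: mult_ac)
        also have "\<dots> = (2 * k * z) powr p" using e that k by simp
        also have "\<dots> = (2 * k) powr p * z powr p" using that k by (simp add: powr_mult)
        finally show ?thesis by (simp add: k_def add_increasing)
      qed
    qed
    have "ennreal (\<Sum>Q\<in>F. d Q * (p / (p - 1) * a Q powr (p - 1)))
        = (\<Sum>Q\<in>F. ennreal (p / (p - 1) * a Q powr (p - 1)) * (\<integral>\<^sup>+x\<in>E Q. ennreal (g x) \<partial>M))"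
      using dfin d0 p by (simp add: mult.commute flip: sum_ennreal ennreal_mult)
    also have "\<dots> = (\<Sum>Q\<in>F. (\<integral>\<^sup>+x\<in>E Q. ennreal (p / (p - 1) * a Q powr (p - 1) * g x) \<partial>M))"
    proof (intro sum.cong refl)
      fix Q assume "Q \<in> F"
      let ?k = "p / (p - 1) * a Q powr (p - 1)"
      have "ennreal ?k * (\<integral>\<^sup>+x\<in>E Q. ennreal (g x) \<partial>M) = (\<integral>\<^sup>+x. ennreal ?k * (ennreal (g x) * indicator (E Q) x) \<partial>M)"
        using E(1)[OF \<open>Q \<in> F\<close>] by (intro nn_integral_cmult[symmetric]) auto
      also have "\<dots> = (\<integral>\<^sup>+x\<in>E Q. ennreal (?k * g x) \<partial>M)"
        using p g(2) by (intro nn_integral_cong) (simp add: mult.assoc[symmetric] flip: ennreal_mult)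
      finally show "ennreal ?k * (\<integral>\<^sup>+x\<in>E Q. ennreal (g x) \<partial>M) = (\<integral>\<^sup>+x\<in>E Q. ennreal (?k * g x) \<partial>M)" .
    qed
    also have "\<dots> \<le> (\<Sum>Q\<in>F. (\<integral>\<^sup>+x\<in>E Q. (ennreal (A x powr p / 2) + ennreal ((2 * p / (p - 1)) powr p * g x powr p)) \<partial>M))"
      using point[OF a(1) g(2)] A_eq
      by (intro sum_mono nn_integral_mono) (auto simp: indicator_def simp flip: ennreal_plus intro!: ennreal_leI)
    also have "\<dots> = (\<integral>\<^sup>+x\<in>(\<Union>Q\<in>F. E Q). (ennreal (A x powr p / 2) + ennreal ((2 * p / (p - 1)) powr p * g x powr p)) \<partial>M)"
      using \<open>finite F\<close> E by (intro nn_integral_UN_finite[symmetric]) auto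
    also have "\<dots> \<le> (\<integral>\<^sup>+x. (ennreal (A x powr p / 2) + ennreal ((2 * p / (p - 1)) powr p * g x powr p)) \<partial>M)"
      by (intro nn_integral_mono) (auto simp: indicator_def)
    also have "\<dots> = (\<integral>\<^sup>+x. ennreal (A x powr p / 2) \<partial>M) + (\<integral>\<^sup>+x. ennreal ((2 * p / (p - 1)) powr p * g x powr p) \<partial>M)"
      by (intro nn_integral_add) auto
    also have "(\<integral>\<^sup>+x. ennreal (A x powr p / 2) \<partial>M) = ennreal (1 / 2) * (\<integral>\<^sup>+x. ennreal (A x powr p) \<partial>M)"
      by (subst nn_integral_cmult[symmetric]) (auto simp: divide_ennreal_def ennreal_mult[of "1/2", symmetric] simp del: ennreal_half)
    also have "(\<integral>\<^sup>+x. ennreal ((2 * p / (p - 1)) powr p * g x powr p) \<partial>M) = ennreal ((2 * p / (p - 1)) powr p) * (\<integral>\<^sup>+x. ennreal (g x powr p) \<partial>M)"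
      by (subst nn_integral_cmult[symmetric]) (auto simp flip: ennreal_mult)
    finally have fin_le: "ennreal (\<Sum>Q\<in>F. d Q * (p / (p - 1) * a Q powr (p - 1)))
      \<le> ennreal (1 / 2) * (\<integral>\<^sup>+x. ennreal (A x powr p) \<partial>M) + ennreal ((2 * p / (p - 1)) powr p) * (\<integral>\<^sup>+x. ennreal (g x powr p) \<partial>M)" .
    define S where "S = (\<Sum>Q\<in>F. c Q * a Q powr p)"
    obtain G where G: "(\<integral>\<^sup>+x. ennreal (g x powr p) \<partial>M) = ennreal G" "0 \<le> G"
      using fin by (cases "(\<integral>\<^sup>+x. ennreal (g x powr p) \<partial>M)") auto
    have S0: "0 \<le> S" using c0 by (auto simp: S_def sum_nonneg)
    have "ennreal S \<le> ennreal (1 / 2) * ennreal S + ennreal ((2 * p / (p - 1)) powr p) * ennreal G"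
      using order.trans[OF ennreal_leI[OF main] fin_le] unfolding int_A G(1) S_def[symmetric] .
    also have "\<dots> = ennreal (1 / 2 * S + (2 * p / (p - 1)) powr p * G)"
      using S0 G(2) by (subst ennreal_mult[symmetric], simp, simp)+ (simp add: ennreal_plus[symmetric] ennreal_mult[symmetric] del: ennreal_plus ennreal_half)
    finally have "ennreal S \<le> ennreal (1 / 2 * S + (2 * p / (p - 1)) powr p * G)" .
    \<comment> \<open>The term S/2 is subtracted, which is legitimate because \<open>S\<close> is a
      finite sum of reals; this is the factor 2 in \<open>?K\<close>.\<close>
    then have "S \<le> ?K * G" using S0 G(2) by (subst (asm) ennreal_le_iff) auto
    then show ?thesis unfolding int_A G(1) S_def[symmetric]
      using G(2) by (simp add: ennreal_leI flip: ennreal_mult)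
  qed
  with Am A0 A_ge show ?thesis using that by blast
qed

section \<open>The Carleson embedding\<close>

lemma sum_UN_le:
  fixes f :: "'a \<Rightarrow> real"
  assumes "finite G" "\<And>R. R \<in> G \<Longrightarrow> finite (A R)" "\<And>R x. R \<in> G \<Longrightarrow> x \<in> A R \<Longrightarrow> 0 \<le> f x"
  shows "sum f (\<Union>R\<in>G. A R) \<le> (\<Sum>R\<in>G. sum f (A R))"
  using assms
proof (induction G rule: finite_induct)
  case (insert R G)
  have "sum f (\<Union>R\<in>insert R G. A R) = sum f (A R) + sum f (\<Union>R\<in>G. A R) - sum f (A R \<inter> (\<Union>R\<in>G. A R))"
    using insert by (simp add: sum_Un)
  also have "\<dots> \<le> sum f (A R) + sum f (\<Union>R\<in>G. A R)"
    using insert.prems(2)[of R] by (auto intro: sum_nonneg)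
  also have "\<dots> \<le> sum f (A R) + (\<Sum>R\<in>G. sum f (A R))"
    using insert.IH insert.prems by (intro add_left_mono) blast
  finally show ?case using insert.hyps by simp
qed simp

text \<open>On a superlevel set of \<open>b\<close> the packing bound holds for each maximal member,
  and superadditivity of x^s transfers it to their disjoint union. \<open>B\<close> is any majorant
  of the maximum of the \<open>b Q\<close>, and only its integral counts. The factor s is the
  derivative of t^s compared with t^(s-1).\<close>

lemma laminar_Carleson_embedding:
  fixes b \<gamma> :: "'i \<Rightarrow> real" and H :: "'i \<Rightarrow> 'b set"
  assumes "finite F" "laminar_on H F" and s: "1 \<le> s"
    and H: "\<And>Q. Q \<in> F \<Longrightarrow> H Q \<in> sets M" "\<And>Q. Q \<in> F \<Longrightarrow> emeasure M (H Q) < \<infinity>"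
    and b: "\<And>Q. Q \<in> F \<Longrightarrow> 0 \<le> b Q" and \<gamma>: "\<And>Q. Q \<in> F \<Longrightarrow> 0 \<le> \<gamma> Q" and "0 \<le> K"
    and packing: "\<And>R. R \<in> F \<Longrightarrow> (\<Sum>Q\<in>{Q\<in>F. H Q \<subseteq> H R}. \<gamma> Q) \<le> K * measure M (H R) powr s"
    and B: "\<And>Q x. Q \<in> F \<Longrightarrow> x \<in> H Q \<Longrightarrow> ennreal (b Q) \<le> B x"
    and I: "(\<integral>\<^sup>+x. B x \<partial>M) \<le> ennreal I" "0 \<le> I"
  shows "(\<Sum>Q\<in>F. \<gamma> Q * b Q powr s) \<le> s * K * I powr s"
proof -
  obtain E where E: "\<And>Q. Q \<in> F \<Longrightarrow> E Q \<in> sets M" "\<And>Q. Q \<in> F \<Longrightarrow> E Q \<subseteq> H Q"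
    "disjoint_family_on E F"
    "\<And>Q x. Q \<in> F \<Longrightarrow> x \<in> H Q \<Longrightarrow> \<exists>R\<in>F. x \<in> E R \<and> b Q \<le> b R"
    using disjoint_selection[of F H M b, OF \<open>finite F\<close> H(1)] by metis
  define c where "c Q = measure M (E Q)" for Q
  have c0: "0 \<le> c Q" for Q by (auto simp: c_def)
  have Efin: "emeasure M (E Q) = ennreal (c Q)" if "Q \<in> F" for Q
    unfolding c_def using emeasure_mono[OF E(2)[OF that] H(1)[OF that]] H(2)[OF that]
    by (intro emeasure_eq_ennreal_measure) (auto simp: top_unique)
  have Hfin: "emeasure M (H Q) = ennreal (measure M (H Q))" if "Q \<in> F" for Q
    using H(2)[OF that] by (intro emeasure_eq_ennreal_measure) auto
  have "ennreal (\<Sum>Q\<in>F. c Q * b Q) = (\<Sum>Q\<in>F. \<integral>\<^sup>+x. ennreal (b Q) * indicator (E Q) x \<partial>M)"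
    using Efin c0 b E(1) by (simp add: nn_integral_cmult_indicator mult.commute flip: sum_ennreal ennreal_mult)
  also have "\<dots> = (\<integral>\<^sup>+x. (\<Sum>Q\<in>F. ennreal (b Q) * indicator (E Q) x) \<partial>M)"
    using E(1) by (intro nn_integral_sum[symmetric]) auto
  also have "\<dots> \<le> (\<integral>\<^sup>+x. B x \<partial>M)"
  proof (rule nn_integral_mono)
    fix x
    show "(\<Sum>Q\<in>F. ennreal (b Q) * indicator (E Q) x) \<le> B x"
    proof (cases "\<exists>Q\<in>F. x \<in> E Q")
      case True
      then obtain Q where Q: "Q \<in> F" "x \<in> E Q" by auto
      then show ?thesis
        using B[of Q x] E(2)[of Q] by (auto simp: sum_indicator_disjoint[OF \<open>finite F\<close> E(3) Q])
    next
      case False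
      then have "(\<Sum>Q\<in>F. ennreal (b Q) * indicator (E Q) x) = 0"
        by (intro sum.neutral) auto
      then show ?thesis by simp
    qed
  qed
  also note I(1)
  finally have sum_le_I: "(\<Sum>Q\<in>F. c Q * b Q) \<le> I" using I(2) by simp
  \<comment> \<open>Chebyshev gives \<open>t * sum c L \<le> I\<close> for a superlevel set
    \<open>L\<close>. So in t^(s-1) (sum c L)^s all but one factor \<open>sum c L\<close> are
    absorbed in I^(s-1), and what remains is additive over \<open>L\<close>.\<close>
  define d where "d Q = K * I powr (s - 1) * c Q" for Q
  have level: "t powr (s - 1) * (\<Sum>Q\<in>{Q\<in>F. t \<le> b Q}. \<gamma> Q) \<le> (\<Sum>Q\<in>{Q\<in>F. t \<le> b Q}. d Q)" if "t \<in> b ` F" for t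
  proof -
    have t0: "0 \<le> t" using that b by auto
    define L where "L = {Q\<in>F. t \<le> b Q}"
    have L: "L \<subseteq> F" "finite L" using \<open>finite F\<close> by (auto simp: L_def)
    have UL: "(\<Union>Q\<in>L. H Q) = (\<Union>Q\<in>L. E Q)"
    proof
      show "(\<Union>Q\<in>L. H Q) \<subseteq> (\<Union>Q\<in>L. E Q)"
        using E(4) unfolding L_def by (fastforce intro: order.trans)
    qed (use E(2) L in blast)
    have disjL: "disjoint_family_on E L" by (rule disjoint_family_on_mono[OF L(1) E(3)])
    obtain G where G: "G \<subseteq> L" "disjoint_family_on H G" "\<And>Q. Q \<in> L \<Longrightarrow> \<exists>R\<in>G. H Q \<subseteq> H R"
      using laminar_maximal[OF L(2) laminar_on_subset[OF \<open>laminar_on H F\<close> L(1)]] by metis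
    have UG: "(\<Union>Q\<in>L. H Q) = (\<Union>Q\<in>G. H Q)" using G by blast
    have finG: "finite G" using G(1) L(2) by (rule finite_subset)
    have GF: "G \<subseteq> F" using G L by auto
    have "ennreal (\<Sum>Q\<in>G. measure M (H Q)) = (\<Sum>Q\<in>G. emeasure M (H Q))"
      using Hfin GF by (simp add: subset_iff flip: sum_ennreal)
    also have "\<dots> = emeasure M (\<Union>Q\<in>G. H Q)"
      using H(1) G L finG by (intro sum_emeasure) auto
    also have "(\<Union>Q\<in>G. H Q) = (\<Union>Q\<in>L. E Q)" using UL UG by simp
    also have "emeasure M (\<Union>Q\<in>L. E Q) = (\<Sum>Q\<in>L. emeasure M (E Q))"
      using E(1) L disjL by (intro sum_emeasure[symmetric]) auto
    also have "\<dots> = ennreal (sum c L)"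
      using Efin L c0 by (simp add: subset_iff flip: sum_ennreal)
    finally have meas: "(\<Sum>Q\<in>G. measure M (H Q)) = sum c L"
      using c0 by (simp add: sum_nonneg)
    have "sum \<gamma> L \<le> sum \<gamma> (\<Union>R\<in>G. {Q\<in>F. H Q \<subseteq> H R})"
      using G(3) L finG \<open>finite F\<close> \<gamma> by (intro sum_mono2) auto
    also have "\<dots> \<le> (\<Sum>R\<in>G. sum \<gamma> {Q\<in>F. H Q \<subseteq> H R})"
      using finG \<open>finite F\<close> \<gamma> by (intro sum_UN_le) auto
    also have "\<dots> \<le> (\<Sum>R\<in>G. K * measure M (H R) powr s)"
      using packing GF by (intro sum_mono) auto
    also have "\<dots> = K * (\<Sum>R\<in>G. measure M (H R) powr s)" by (simp add: sum_distrib_left)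
    also have "\<dots> \<le> K * (\<Sum>R\<in>G. measure M (H R)) powr s"
      using finG s \<open>0 \<le> K\<close> by (intro mult_left_mono sum_powr_le_powr_sum) auto
    finally have 1: "sum \<gamma> L \<le> K * sum c L powr s" unfolding meas .
    have C0: "0 \<le> sum c L" using c0 by (auto intro: sum_nonneg)
    have "t * sum c L = (\<Sum>Q\<in>L. c Q * t)" by (simp add: sum_distrib_left mult.commute)
    also have "\<dots> \<le> (\<Sum>Q\<in>L. c Q * b Q)" using c0 by (intro sum_mono mult_left_mono) (auto simp: L_def)
    also have "\<dots> \<le> (\<Sum>Q\<in>F. c Q * b Q)" using L \<open>finite F\<close> c0 b by (intro sum_mono2) auto
    also note sum_le_I
    finally have 2: "t * sum c L \<le> I" .
    have e: "x powr s = x powr (s - 1) * x" if "0 \<le> x" for x :: real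
      using that by (cases "x = 0") (auto simp: powr_mult_base mult.commute)
    have "t powr (s - 1) * sum \<gamma> L \<le> t powr (s - 1) * (K * sum c L powr s)"
      using 1 by (intro mult_left_mono) auto
    also have "\<dots> = K * (t * sum c L) powr (s - 1) * sum c L"
      using t0 C0 by (simp add: powr_mult e)
    also have "\<dots> \<le> K * I powr (s - 1) * sum c L"
      using 2 \<open>0 \<le> K\<close> C0 t0 s by (intro mult_right_mono mult_left_mono powr_mono2) auto
    also have "\<dots> = sum d L" by (simp add: d_def sum_distrib_left)
    finally show ?thesis by (simp add: L_def)
  qed
  have "(\<Sum>Q\<in>F. \<gamma> Q * b Q powr s) \<le> (\<Sum>Q\<in>F. d Q * (s * b Q))"
  proof (rule sum_le_sum_of_level_sums[OF \<open>finite F\<close> b \<gamma> level])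
    show "t powr s - r powr s \<le> t powr (s - 1) * (s * t - s * r)" if "0 \<le> r" "r \<le> t" for r t :: real
      using powr_diff_le[OF s that] .
  qed (use s in auto)
  also have "\<dots> = s * K * I powr (s - 1) * (\<Sum>Q\<in>F. c Q * b Q)"
    by (simp add: d_def sum_distrib_left mult_ac)
  also have "\<dots> \<le> s * K * I powr (s - 1) * I"
    using sum_le_I s \<open>0 \<le> K\<close> by (intro mult_left_mono) auto
  also have "\<dots> = s * K * I powr s"
    using I(2) by (cases "I = 0") (auto simp: powr_mult_base mult.commute)
  finally show ?thesis .
qed

section \<open>Hoelder's inequality for several functions\<close>

text \<open>Apply ln y <= y - 1 to y = x_i/A with A the arithmetic mean: the corrections cancel
  after weighting.\<close>

lemma weighted_arith_geom_mean:
  fixes x \<theta> :: "'a \<Rightarrow> real"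
  assumes "finite I" "\<And>i. i \<in> I \<Longrightarrow> 0 < \<theta> i" "sum \<theta> I = 1" "\<And>i. i \<in> I \<Longrightarrow> 0 \<le> x i"
  shows "(\<Prod>i\<in>I. x i powr \<theta> i) \<le> (\<Sum>i\<in>I. \<theta> i * x i)"
proof (cases "\<exists>i\<in>I. x i = 0")
  case True
  then have "(\<Prod>i\<in>I. x i powr \<theta> i) = 0" using assms(1) by auto
  moreover have "0 \<le> (\<Sum>i\<in>I. \<theta> i * x i)" using assms by (intro sum_nonneg mult_nonneg_nonneg) (auto intro: less_imp_le)
  ultimately show ?thesis by simp
next
  case False
  then have x: "0 < x i" if "i \<in> I" for i using assms(4)[OF that] that by fastforce
  have xne: "x i \<noteq> 0" if "i \<in> I" for i using False that by auto
  define A where "A = (\<Sum>i\<in>I. \<theta> i * x i)"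
  have "I \<noteq> {}" using assms(3) by auto
  then have A: "0 < A" unfolding A_def using assms x by (intro sum_pos) auto
  have "ln (\<Prod>i\<in>I. x i powr \<theta> i) = (\<Sum>i\<in>I. ln (x i powr \<theta> i))"
    using xne assms(1) by (intro ln_prod) auto
  also have "\<dots> = (\<Sum>i\<in>I. \<theta> i * ln (x i))"
    using xne by (intro sum.cong refl) (simp add: ln_powr)
  also have "\<dots> \<le> (\<Sum>i\<in>I. \<theta> i * (ln A + (x i / A - 1)))"
  proof (intro sum_mono mult_left_mono)
    fix i assume "i \<in> I"
    have "ln (x i / A) \<le> x i / A - 1" using x[OF \<open>i \<in> I\<close>] A by (intro ln_le_minus_one) auto
    then show "ln (x i) \<le> ln A + (x i / A - 1)" using x[OF \<open>i \<in> I\<close>] A by (simp add: ln_div)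
    show "0 \<le> \<theta> i" using assms(2)[OF \<open>i \<in> I\<close>] by simp
  qed
  also have "\<dots> = (ln A - 1) * sum \<theta> I + (\<Sum>i\<in>I. \<theta> i * x i) / A"
    by (simp add: algebra_simps sum.distrib sum_subtractf sum_distrib_left sum_divide_distrib)
  also have "\<dots> = ln A" using A by (simp add: assms(3) flip: A_def)
  finally have "ln (\<Prod>i\<in>I. x i powr \<theta> i) \<le> ln A" .
  moreover have "0 < (\<Prod>i\<in>I. x i powr \<theta> i)" using xne by (intro prod_pos) auto
  ultimately show ?thesis using A by (simp add: A_def)
qed

text \<open>Hoelder with exponents 1/theta_i: pointwise arithmetic-geometric mean for the normalised
  functions h_i/N_i. Taking positive upper bounds \<open>N i\<close> in place of the integrals
  avoids division by zero.\<close>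

lemma nn_integral_prod_powr_le:
  fixes h :: "'i \<Rightarrow> 'a \<Rightarrow> real" and \<theta> N :: "'i \<Rightarrow> real"
  assumes "finite I" "\<And>i. i \<in> I \<Longrightarrow> 0 < \<theta> i" "sum \<theta> I = 1"
    and h: "\<And>i x. i \<in> I \<Longrightarrow> 0 \<le> h i x" "\<And>i. i \<in> I \<Longrightarrow> h i \<in> borel_measurable M"
    and N: "\<And>i. i \<in> I \<Longrightarrow> 0 < N i" "\<And>i. i \<in> I \<Longrightarrow> (\<integral>\<^sup>+x. ennreal (h i x) \<partial>M) \<le> ennreal (N i)"
  shows "(\<integral>\<^sup>+x. ennreal (\<Prod>i\<in>I. h i x powr \<theta> i) \<partial>M) \<le> ennreal (\<Prod>i\<in>I. N i powr \<theta> i)"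
proof -
  let ?P = "\<Prod>i\<in>I. N i powr \<theta> i"
  have P: "0 \<le> ?P" by (intro prod_nonneg) auto
  have pt: "ennreal (\<Prod>i\<in>I. h i x powr \<theta> i) \<le> ennreal ?P * (\<Sum>i\<in>I. ennreal (\<theta> i / N i) * ennreal (h i x))" for x
  proof -
    have "(\<Prod>i\<in>I. h i x powr \<theta> i) = (\<Prod>i\<in>I. N i powr \<theta> i * (h i x / N i) powr \<theta> i)"
      using N(1) h(1) by (intro prod.cong refl) (simp add: powr_divide order.strict_implies_not_eq[THEN not_sym])
    also have "\<dots> = ?P * (\<Prod>i\<in>I. (h i x / N i) powr \<theta> i)" by (simp add: prod.distrib)
    also have "\<dots> \<le> ?P * (\<Sum>i\<in>I. \<theta> i * (h i x / N i))"
      using assms(1-3) h(1) P less_imp_le[OF N(1)]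
      by (intro mult_left_mono weighted_arith_geom_mean) auto
    finally have "ennreal (\<Prod>i\<in>I. h i x powr \<theta> i) \<le> ennreal (?P * (\<Sum>i\<in>I. \<theta> i * (h i x / N i)))"
      by (rule ennreal_leI)
    also have "\<dots> = ennreal ?P * (\<Sum>i\<in>I. ennreal (\<theta> i / N i) * ennreal (h i x))"
    proof -
      have "ennreal (\<theta> i / N i) * ennreal (h i x) = ennreal (\<theta> i * (h i x / N i))" if "i \<in> I" for i
        using assms(2)[OF that] N(1)[OF that] h(1)[OF that] by (simp flip: ennreal_mult)
      moreover have "0 \<le> \<theta> i * (h i x / N i)" if "i \<in> I" for i
        using assms(2)[OF that] N(1)[OF that] h(1)[OF that] by simp
      ultimately show ?thesis using P by (simp add: ennreal_mult sum_nonneg flip: sum_ennreal)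
    qed
    finally show ?thesis .
  qed
  have "(\<integral>\<^sup>+x. ennreal (\<Prod>i\<in>I. h i x powr \<theta> i) \<partial>M)
     \<le> (\<integral>\<^sup>+x. ennreal ?P * (\<Sum>i\<in>I. ennreal (\<theta> i / N i) * ennreal (h i x)) \<partial>M)"
    by (intro nn_integral_mono pt)
  also have "\<dots> = ennreal ?P * (\<Sum>i\<in>I. ennreal (\<theta> i / N i) * (\<integral>\<^sup>+x. ennreal (h i x) \<partial>M))"
    using h(2) by (simp add: nn_integral_cmult nn_integral_sum)
  also have "\<dots> \<le> ennreal ?P * (\<Sum>i\<in>I. ennreal (\<theta> i / N i) * ennreal (N i))"
    using N(2) by (intro mult_left_mono sum_mono) auto
  also have "(\<Sum>i\<in>I. ennreal (\<theta> i / N i) * ennreal (N i)) = (\<Sum>i\<in>I. ennreal (\<theta> i))"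
  proof (intro sum.cong refl)
    fix i assume "i \<in> I"
    then show "ennreal (\<theta> i / N i) * ennreal (N i) = ennreal (\<theta> i)"
      using assms(2)[of i] N(1)[of i] by (simp flip: ennreal_mult)
  qed
  also have "\<dots> = 1" using assms(2,3) by (subst sum_ennreal) (auto intro: less_imp_le)
  finally show ?thesis by simp
qed

section \<open>Cubes, weights and the exponential-logarithmic mean\<close>

lemma epowr_ennreal: "0 \<le> x \<Longrightarrow> epowr (ennreal x) r = ennreal (x powr r)"
  by (simp add: epowr_def)

lemma epowr_top [simp]: "epowr top r = top"
  by (simp add: epowr_def)

lemma epowr_zero [simp]: "epowr 0 r = 0"
  by (simp add: epowr_def)

lemma epowr_mono: "0 \<le> r \<Longrightarrow> x \<le> y \<Longrightarrow> epowr x r \<le> epowr y r"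
  by (cases x; cases y) (auto simp: epowr_ennreal top_unique intro!: ennreal_leI powr_mono2)

lemma epowr_epowr: "epowr (epowr x r) s = epowr x (r * s)"
  by (cases x) (auto simp: epowr_ennreal powr_powr)

lemma epowr_one [simp]: "epowr x 1 = x"
  by (cases x) (auto simp: epowr_ennreal)

lemma epowr_le_iff: "0 < r \<Longrightarrow> epowr x r \<le> y \<longleftrightarrow> x \<le> epowr y (1 / r)"
  using epowr_mono[of "1 / r" "epowr x r" y] epowr_mono[of r x "epowr y (1 / r)"]
  by (auto simp: epowr_epowr)

text \<open>\<open>epowr_le_iff\<close> makes the power a lower adjoint, so suprema pass through it
  without a continuity argument.\<close>

lemma epowr_SUP_le: "0 < r \<Longrightarrow> (\<And>i. i \<in> I \<Longrightarrow> epowr (f i) r \<le> z) \<Longrightarrow> epowr (SUP i\<in>I. f i) r \<le> z"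
  by (simp add: epowr_le_iff SUP_le_iff)

lemma prod_epowr_ennreal:
  "(\<And>i. i \<in> I \<Longrightarrow> 0 \<le> x i) \<Longrightarrow> (\<Prod>i\<in>I. epowr (ennreal (x i)) (r i)) = ennreal (\<Prod>i\<in>I. x i powr r i)"
  by (simp add: epowr_ennreal prod_ennreal cong: prod.cong)

lemma prod_powr_powr: "(\<Prod>i\<in>I. x i powr r i) powr s = (\<Prod>i\<in>I. x i powr (r i * s))"
  for x r :: "'i \<Rightarrow> real"
  by (induction I rule: infinite_finite_induct) (auto simp: powr_mult prod_nonneg powr_powr)

section \<open>Cubes and masses of weights\<close>

lemma cubes_obtain:
  assumes "C \<in> cubes"
  obtains a :: "real ^ 'n" and l where "0 < l" "C = cbox a (a + (\<chi> i. l))"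
  using assms by (auto simp: cubes_def)

lemma measure_cube: "0 < l \<Longrightarrow> measure lebesgue (cbox a (a + (\<chi> i. l))) = l ^ CARD('n)"
  for a :: "real ^ 'n"
  by (simp add: content_cbox_if_cart interval_ne_empty_cart)

lemma cube_sets [measurable]: "C \<in> cubes \<Longrightarrow> C \<in> sets lebesgue"
  by (auto simp: cubes_def)

lemma cube_compact: "C \<in> cubes \<Longrightarrow> compact C"
  by (auto simp: cubes_def)

lemma cube_measure_pos: "C \<in> cubes \<Longrightarrow> 0 < measure lebesgue C"
  by (erule cubes_obtain) (simp only: measure_cube zero_less_power)

lemma cube_emeasure: "C \<in> cubes \<Longrightarrow> emeasure lebesgue C = ennreal (measure lebesgue C)"
  by (erule cubes_obtain) (simp add: emeasure_eq_measure2 del: emeasure_lborel_cbox measure_lborel_cbox)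

lemma weight_measurable [measurable]: "weight w \<Longrightarrow> w \<in> borel_measurable lebesgue"
  by (simp add: weight_def locally_integrable_def)

lemma weight_mass_finite:
  assumes "weight w" "C \<in> cubes"
  shows "weight_mass w C < \<infinity>"
proof -
  have "integrable lebesgue (\<lambda>x. indicator C x *\<^sub>R w x)"
    using assms(1) cube_compact[OF assms(2)]
    unfolding weight_def locally_integrable_def set_integrable_def by blast
  then have "(\<integral>\<^sup>+x. ennreal (norm (indicator C x *\<^sub>R w x)) \<partial>lebesgue) < \<infinity>"
    by (simp add: integrable_iff_bounded)
  moreover have "weight_mass w C \<le> (\<integral>\<^sup>+x. ennreal (norm (indicator C x *\<^sub>R w x)) \<partial>lebesgue)"
    unfolding weight_mass_def by (intro nn_integral_mono) (auto simp: indicator_def intro: ennreal_leI)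
  ultimately show ?thesis by simp
qed

lemma weight_mass_pos:
  assumes "weight w" "C \<in> cubes"
  shows "0 < weight_mass w C"
proof (rule ccontr)
  assume "\<not> 0 < weight_mass w C"
  then have "(\<integral>\<^sup>+x\<in>C. ennreal (w x) \<partial>lebesgue) = 0" by (simp add: weight_mass_def)
  then have "AE x in lebesgue. ennreal (w x) * indicator C x = 0"
    using assms by (subst (asm) nn_integral_0_iff_AE) auto
  moreover have "AE x in lebesgue. 0 < w x" using assms by (simp add: weight_def)
  ultimately have "AE x in lebesgue. x \<notin> C"
    by eventually_elim (auto simp: indicator_def split: if_splits)
  then have "emeasure lebesgue C = 0"
    using assms by (subst (asm) AE_iff_measurable[of C]) auto
  then show False using cube_emeasure[OF assms(2)] cube_measure_pos[OF assms(2)] by simp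
qed

text \<open>\<open>h\<close> may change sign: \<open>ennreal\<close> truncates its negative values
  to 0, which can only increase the integral. This admits the affine minorant of an exponential in
  the Jensen argument below.\<close>

lemma ennreal_integral_le_nn_integral:
  assumes "integrable M h"
  shows "ennreal (integral\<^sup>L M h) \<le> (\<integral>\<^sup>+x. ennreal (h x) \<partial>M)"
proof -
  have int: "integrable M (\<lambda>x. max 0 (h x))" using assms by simp
  have "ennreal (integral\<^sup>L M h) \<le> ennreal (integral\<^sup>L M (\<lambda>x. max 0 (h x)))"
    using assms int by (intro ennreal_leI integral_mono) auto
  also have "\<dots> = (\<integral>\<^sup>+x. ennreal (max 0 (h x)) \<partial>M)"
    by (intro nn_integral_eq_integral[symmetric] int) auto
  also have "\<dots> = (\<integral>\<^sup>+x. ennreal (h x) \<partial>M)"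
    by (intro nn_integral_cong) (auto simp: max_def ennreal_neg)
  finally show ?thesis .
qed

text \<open>The A_infinity condition read as a reverse Jensen inequality: the arithmetic mean of
  \<open>w\<close> is at most \<open>B\<close> times its geometric mean.\<close>

lemma exp_log_mean_bound:
  assumes "weight w" "C \<in> cubes" "A_infty_const w \<le> ennreal B" "0 \<le> B"
  obtains L where "integrable lebesgue (\<lambda>x. indicator C x *\<^sub>R ln (w x))"
    "L = integral\<^sup>L lebesgue (\<lambda>x. indicator C x *\<^sub>R ln (w x))"
    "enn2real (weight_mass w C) \<le> measure lebesgue C * (B * exp (L / measure lebesgue C))"
proof -
  let ?V = "measure lebesgue C"
  define s where "s = enn2real (weight_mass w C)"
  have s: "weight_mass w C = ennreal s" "0 < s"
    using weight_mass_finite[OF assms(1,2)] weight_mass_pos[OF assms(1,2)]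
    by (auto simp: s_def enn2real_positive_iff)
  have V: "0 < ?V" using cube_measure_pos[OF assms(2)] .
  have "weight_mass w C / emeasure lebesgue C * exp_log_mean w C \<le> A_infty_const w"
    unfolding A_infty_const_def by (intro SUP_upper assms)
  then have le: "ennreal (s / ?V) * exp_log_mean w C \<le> ennreal B"
    using assms(3) s V by (simp add: cube_emeasure[OF assms(2)] divide_ennreal)
  \<comment> \<open>If ln w were not integrable, \<open>exp_log_mean\<close> would be infinite;
    multiplied by the positive mean of \<open>w\<close> it would exceed the finite bound.\<close>
  have "set_integrable lebesgue C (\<lambda>x. ln (inverse (w x)))"
  proof (rule ccontr)
    assume "\<not> ?thesis"
    then have "exp_log_mean w C = top" by (simp add: exp_log_mean_def)
    with le s V show False by (simp add: ennreal_mult_top top_unique divide_eq_0_iff)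
  qed
  then have int: "integrable lebesgue (\<lambda>x. - (indicator C x *\<^sub>R ln (w x)))"
    by (simp add: set_integrable_def ln_inverse)
  define L where "L = integral\<^sup>L lebesgue (\<lambda>x. indicator C x *\<^sub>R ln (w x))"
  have "exp_log_mean w C = ennreal (exp (- L / ?V))"
    using \<open>set_integrable lebesgue C _\<close> by (simp add: exp_log_mean_def set_lebesgue_integral_def ln_inverse L_def)
  with le have "ennreal (s / ?V) * ennreal (exp (- L / ?V)) \<le> ennreal B" by simp
  then have "ennreal (s / ?V * exp (- L / ?V)) \<le> ennreal B" using s V by (subst ennreal_mult) auto
  then have "s / ?V * exp (- L / ?V) \<le> B" using assms(4) by simp
  then have "s \<le> ?V * (B * exp (L / ?V))"
    using V by (simp add: exp_minus field_simps)
  then show ?thesis using that[of L] int L_def by (simp add: s_def)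
qed

text \<open>Jensen's inequality in the form \<open>exp u \<ge> exp c * (1 + u - c)\<close>, with \<open>c\<close> the mean of \<open>u\<close>.\<close>

lemma A_infty_prod_mass_le:
  fixes \<sigma> :: "'i \<Rightarrow> real ^ 'n \<Rightarrow> real"
  assumes I: "finite I" "\<And>i. i \<in> I \<Longrightarrow> 0 < \<theta> i" "sum \<theta> I = 1"
    and C: "C \<in> cubes" and \<sigma>: "\<And>i. i \<in> I \<Longrightarrow> weight (\<sigma> i)"
    and B: "\<And>i. i \<in> I \<Longrightarrow> A_infty_const (\<sigma> i) \<le> ennreal B" "0 < B"
  shows "ennreal (\<Prod>i\<in>I. enn2real (weight_mass (\<sigma> i) C) powr \<theta> i)
    \<le> ennreal B * (\<integral>\<^sup>+x\<in>C. ennreal (\<Prod>i\<in>I. \<sigma> i x powr \<theta> i) \<partial>lebesgue)"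
proof -
  let ?V = "measure lebesgue C"
  have V: "0 < ?V" using cube_measure_pos[OF C] .
  define L where "L i = integral\<^sup>L lebesgue (\<lambda>x. indicator C x *\<^sub>R ln (\<sigma> i x))" for i
  have int: "integrable lebesgue (\<lambda>x. indicator C x *\<^sub>R ln (\<sigma> i x))"
    and le: "enn2real (weight_mass (\<sigma> i) C) \<le> ?V * (B * exp (L i / ?V))" if "i \<in> I" for i
    using exp_log_mean_bound[OF \<sigma>[OF that] C B(1)[OF that]] B(2) unfolding L_def by (metis less_imp_le)+
  define c where "c = (\<Sum>i\<in>I. \<theta> i * L i) / ?V"
  define u where "u x = (\<Sum>i\<in>I. \<theta> i * ln (\<sigma> i x))" for x
  have "(\<Prod>i\<in>I. enn2real (weight_mass (\<sigma> i) C) powr \<theta> i) \<le> (\<Prod>i\<in>I. (?V * (B * exp (L i / ?V))) powr \<theta> i)"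
    using le I(2) by (intro prod_mono conjI powr_mono2) (auto intro: less_imp_le)
  also have "\<dots> = (\<Prod>i\<in>I. (?V * B) powr \<theta> i * exp (\<theta> i * L i / ?V))"
    using V B(2) by (intro prod.cong refl) (simp add: powr_mult exp_powr_real mult_ac)
  \<comment> \<open>As the exponents add up to 1, volume and constant come out to the first
    power.\<close>
  also have "\<dots> = (?V * B) * exp c"
    using I V B(2) by (simp add: prod.distrib exp_sum c_def sum_divide_distrib flip: powr_sum)
  finally have 1: "ennreal (\<Prod>i\<in>I. enn2real (weight_mass (\<sigma> i) C) powr \<theta> i) \<le> ennreal (B * (?V * exp c))"
    by (intro ennreal_leI) (simp add: mult_ac)
  have intu: "integrable lebesgue (\<lambda>x. indicator C x *\<^sub>R u x)"
  proof -
    have "integrable lebesgue (\<lambda>x. \<Sum>i\<in>I. \<theta> i * (indicator C x *\<^sub>R ln (\<sigma> i x)))"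
      using int by auto
    then show ?thesis by (simp add: u_def sum_distrib_left mult_ac)
  qed
  have intu_eq: "integral\<^sup>L lebesgue (\<lambda>x. indicator C x *\<^sub>R u x) = c * ?V"
  proof -
    have "integral\<^sup>L lebesgue (\<lambda>x. indicator C x *\<^sub>R u x) = integral\<^sup>L lebesgue (\<lambda>x. \<Sum>i\<in>I. \<theta> i * (indicator C x *\<^sub>R ln (\<sigma> i x)))"
      by (simp add: u_def sum_distrib_left mult_ac)
    also have "\<dots> = (\<Sum>i\<in>I. \<theta> i * L i)" using int by (simp add: L_def)
    finally show ?thesis using V by (simp add: c_def)
  qed
  have intC: "integrable lebesgue (indicator C :: _ \<Rightarrow> real)"
    using C cube_emeasure[OF C] by (intro integrable_real_indicator) auto
  \<comment> \<open>On \<open>C\<close> this is the tangent minorant exp c (1 + u - c) of exp u.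
    Since u - c has mean zero over \<open>C\<close>, its integral is the volume times exp c.\<close>
  define h where "h x = exp c * ((1 - c) * indicator C x + indicator C x *\<^sub>R u x)" for x
  have "integrable lebesgue h" unfolding h_def using intu intC by auto
  moreover have "integral\<^sup>L lebesgue h = ?V * exp c"
    unfolding h_def using intu intC intu_eq C by (simp add: algebra_simps)
  ultimately have "ennreal (?V * exp c) \<le> (\<integral>\<^sup>+x. ennreal (h x) \<partial>lebesgue)"
    using ennreal_integral_le_nn_integral[of lebesgue h] by simp
  also have "\<dots> \<le> (\<integral>\<^sup>+x\<in>C. ennreal (\<Prod>i\<in>I. \<sigma> i x powr \<theta> i) \<partial>lebesgue)"
  proof (rule nn_integral_mono_AE)
    have "AE x in lebesgue. \<forall>i\<in>I. 0 < \<sigma> i x"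
      using \<sigma> I(1) by (intro AE_finite_allI) (auto simp: weight_def)
    then show "AE x in lebesgue. ennreal (h x) \<le> ennreal (\<Prod>i\<in>I. \<sigma> i x powr \<theta> i) * indicator C x"
    proof eventually_elim
      case (elim x)
      have "exp c * (1 + (u x - c)) \<le> exp c * exp (u x - c)"
        by (intro mult_left_mono exp_ge_add_one_self) auto
      also have "\<dots> = exp (u x)" by (simp flip: exp_add)
      also have "\<dots> = (\<Prod>i\<in>I. \<sigma> i x powr \<theta> i)"
        using elim I(1) by (simp add: u_def exp_sum powr_def order.strict_iff_order cong: prod.cong)
      finally show ?case by (auto simp: h_def indicator_def algebra_simps intro: ennreal_leI)
    qed
  qed
  finally have 2: "ennreal (?V * exp c) \<le> (\<integral>\<^sup>+x\<in>C. ennreal (\<Prod>i\<in>I. \<sigma> i x powr \<theta> i) \<partial>lebesgue)" .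
  have "ennreal (B * (?V * exp c)) = ennreal B * ennreal (?V * exp c)" using B(2) V by (simp add: ennreal_mult)
  also have "\<dots> \<le> ennreal B * (\<integral>\<^sup>+x\<in>C. ennreal (\<Prod>i\<in>I. \<sigma> i x powr \<theta> i) \<partial>lebesgue)"
    using 2 by (intro mult_left_mono) auto
  finally show ?thesis using 1 by (rule order.trans[rotated])
qed

section \<open>Shifted 4-adic grids\<close>

text \<open>Side lengths are powers of 4, since \<open>4 / 3\<close> differs from \<open>1 / 3\<close> by an integer: this makes the
  grids translated by one third of the side length nested across scales.\<close>

definition cell :: "('n \<Rightarrow> bool) \<Rightarrow> int \<times> ('n \<Rightarrow> int) \<Rightarrow> (real ^ 'n) set" where
  "cell b Q = {x. \<forall>i. \<lfloor>x $ i / 4 powi fst Q - of_bool (b i) / 3\<rfloor> = snd Q i}"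

text \<open>The closure of the cell. Half-open cells are what makes a grid laminar, while
  \<open>cubes\<close> consists of closed boxes; the two differ by a null set, and both are carried
  along as the pair H, C in the abstract lemmas.\<close>

definition cell_cube :: "('n \<Rightarrow> bool) \<Rightarrow> int \<times> ('n \<Rightarrow> int) \<Rightarrow> (real ^ 'n) set" where
  "cell_cube b Q =
     (let a = (\<chi> i. 4 powi fst Q * (of_int (snd Q i) + of_bool (b i) / 3))
      in cbox a (a + (\<chi> i. 4 powi fst Q)))"

lemma cell_cube_in_cubes: "cell_cube b Q \<in> cubes"
proof -
  have "(0::real) < 4 powi fst Q" by simp
  then show ?thesis unfolding cell_cube_def cubes_def Let_def by blast
qed

lemma measure_cell_cube: "measure lebesgue (cell_cube b Q :: (real ^ 'n) set) = (4 powi fst Q) ^ CARD('n)"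
  unfolding cell_cube_def Let_def by (rule measure_cube) simp

lemma cell_subset_cube: "cell b Q \<subseteq> cell_cube b Q"
proof
  fix x assume x: "x \<in> cell b Q"
  show "x \<in> cell_cube b Q"
    unfolding cell_cube_def Let_def mem_box_cart
  proof (intro allI)
    fix i
    have h: "(0::real) < 4 powi fst Q" by simp
    have "\<lfloor>x $ i / 4 powi fst Q - of_bool (b i) / 3\<rfloor> = snd Q i" using x by (simp add: cell_def)
    then have "of_int (snd Q i) + of_bool (b i) / 3 \<le> x $ i / 4 powi fst Q"
      "x $ i / 4 powi fst Q \<le> of_int (snd Q i) + of_bool (b i) / 3 + 1"
      unfolding floor_eq_iff by linarith+
    then show "(\<chi> i. 4 powi fst Q * (of_int (snd Q i) + of_bool (b i) / 3)) $ i \<le> x $ i \<and>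
      x $ i \<le> ((\<chi> i. 4 powi fst Q * (of_int (snd Q i) + of_bool (b i) / 3)) + (\<chi> i. 4 powi fst Q)) $ i"
      using h by (simp add: field_simps)
  qed
qed

lemma cell_cube_diff_null: "cell_cube b Q - cell b Q \<in> null_sets lebesgue"
proof -
  let ?a = "(\<chi> i. 4 powi fst Q * (of_int (snd Q i) + of_bool (b i) / 3)) :: real ^ 'a"
  let ?c = "?a + (\<chi> i. 4 powi fst Q)"
  have "box ?a ?c \<subseteq> cell b Q"
  proof
    fix x assume x: "x \<in> box ?a ?c"
    show "x \<in> cell b Q"
      unfolding cell_def mem_Collect_eq floor_eq_iff
    proof (intro allI)
      fix i
      have h: "(0::real) < 4 powi fst Q" by simp
      have "?a $ i < x $ i" "x $ i < ?c $ i" using x by (auto simp: mem_box_cart)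
      then have "of_int (snd Q i) + of_bool (b i) / 3 < x $ i / 4 powi fst Q"
        "x $ i / 4 powi fst Q < of_int (snd Q i) + of_bool (b i) / 3 + 1"
        using h by (simp_all add: field_simps)
      then show "of_int (snd Q i) \<le> x $ i / 4 powi fst Q - of_bool (b i) / 3 \<and>
        x $ i / 4 powi fst Q - of_bool (b i) / 3 < of_int (snd Q i) + 1" by linarith
    qed
  qed
  then have "cell_cube b Q - cell b Q \<subseteq> cbox ?a ?c - box ?a ?c"
    unfolding cell_cube_def Let_def by blast
  then have "negligible (cell_cube b Q - cell b Q)"
    using negligible_frontier_interval negligible_subset by blast
  then show ?thesis by (simp add: negligible_iff_null_sets)
qed

lemma cell_sets: "cell b Q \<in> sets lebesgue"
proof -
  have "cell b Q = cell_cube b Q - (cell_cube b Q - cell b Q)" using cell_subset_cube by blast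
  moreover have "cell_cube b Q - (cell_cube b Q - cell b Q) \<in> sets lebesgue"
    by (rule sets.Diff[OF cube_sets[OF cell_cube_in_cubes] null_setsD2[OF cell_cube_diff_null]])
  ultimately show ?thesis by simp
qed

text \<open>Since 4/3 = 1/3 + 1, coarsening the scale subtracts the integer c and divides by 4. Thus
  the coarse index is a function of the fine one, which is exactly nestedness.\<close>

lemma floor_shift_coarsen:
  fixes y h :: real
  shows "\<lfloor>y / (h * 4) - of_bool c / 3\<rfloor> = (\<lfloor>y / h - of_bool c / 3\<rfloor> - of_bool c) div 4"
proof -
  have "y / (h * 4) - of_bool c / 3 = (y / h - of_bool c / 3 - of_bool c) / of_int 4"
    by (cases c) (simp_all add: field_simps)
  then have "\<lfloor>y / (h * 4) - of_bool c / 3\<rfloor> = \<lfloor>y / h - of_bool c / 3 - of_bool c\<rfloor> div 4"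
    by (simp only: floor_divide_real_eq_div[of 4])
  also have "\<lfloor>y / h - of_bool c / 3 - of_bool c\<rfloor> = \<lfloor>y / h - of_bool c / 3\<rfloor> - of_bool c"
    using floor_diff_of_int[of "y / h - of_bool c / 3" "of_bool c"] by (simp only: of_int_of_bool)
  finally show ?thesis .
qed

lemma floor_shift_nested:
  fixes y z :: real
  assumes "k \<le> l" "\<lfloor>y / 4 powi k - of_bool c / 3\<rfloor> = \<lfloor>z / 4 powi k - of_bool c / 3\<rfloor>"
  shows "\<lfloor>y / 4 powi l - of_bool c / 3\<rfloor> = \<lfloor>z / 4 powi l - of_bool c / 3\<rfloor>"
  using assms(1)
proof (induction l rule: int_ge_induct)
  case (step l)
  have "(4::real) powi (l + 1) = 4 powi l * 4" by (simp add: power_int_add_1)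
  then show ?case by (simp only: floor_shift_coarsen step.IH)
qed (use assms in simp)

lemma laminar_cells: "laminar_on (cell b) UNIV"
proof -
  have nest: "cell b Q \<inter> cell b R = {} \<or> cell b Q \<subseteq> cell b R" if le: "fst Q \<le> fst R" for Q R :: "int \<times> ('a \<Rightarrow> int)"
  proof (rule disjCI)
    assume "\<not> cell b Q \<subseteq> cell b R"
    show "cell b Q \<inter> cell b R = {}"
    proof (rule ccontr)
      assume "cell b Q \<inter> cell b R \<noteq> {}"
      then obtain z where z: "z \<in> cell b Q" "z \<in> cell b R" by blast
      have "x \<in> cell b R" if x: "x \<in> cell b Q" for x
        unfolding cell_def mem_Collect_eq
      proof
        fix i
        have "\<lfloor>x $ i / 4 powi fst R - of_bool (b i) / 3\<rfloor> = \<lfloor>z $ i / 4 powi fst R - of_bool (b i) / 3\<rfloor>"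
          using x z(1) by (intro floor_shift_nested[OF le]) (simp only: cell_def mem_Collect_eq)
        then show "\<lfloor>x $ i / 4 powi fst R - of_bool (b i) / 3\<rfloor> = snd R i"
          using z(2) by (simp only: cell_def mem_Collect_eq)
      qed
      with \<open>\<not> cell b Q \<subseteq> cell b R\<close> show False by blast
    qed
  qed
  show ?thesis unfolding laminar_on_def
    using nest by (metis Int_commute linear)
qed

text \<open>Integers and integers shifted by 1/3 are at least 1/3 apart, so an interval shorter than
  that crosses a breakpoint of at most one of the two grids.\<close>

lemma exists_shifted_cell_1d:
  fixes u d :: real
  assumes "0 < d" "d < 1 / 3"
  shows "\<exists>c. \<lfloor>u - of_bool c / 3\<rfloor> = \<lfloor>u + d - of_bool c / 3\<rfloor>"
proof (cases "\<lfloor>u\<rfloor> = \<lfloor>u + d\<rfloor>")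
  case True
  then show ?thesis by (intro exI[of _ False]) simp
next
  case False
  define N where "N = \<lfloor>u + d\<rfloor>"
  have "\<lfloor>u\<rfloor> \<le> N" unfolding N_def using assms by (intro floor_mono) simp
  with False have "\<lfloor>u\<rfloor> < N" by (simp add: N_def)
  then have "u < of_int N" by (simp add: floor_less_iff)
  moreover have "of_int N \<le> u + d" by (simp add: N_def)
  ultimately have "\<lfloor>u - 1 / 3\<rfloor> = N - 1" "\<lfloor>u + d - 1 / 3\<rfloor> = N - 1"
    unfolding floor_eq_iff using assms by auto
  then show ?thesis by (intro exI[of _ True]) simp
qed

text \<open>The factor 3 brings l/4^k below 1/3, as the shifted grids require; consecutive powers
  differ by 4, whence 12 = 3 * 4.\<close>

lemma exists_scale:
  fixes l :: real
  assumes "0 < l"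
  obtains k :: int where "3 * l < 4 powi k" "4 powi k \<le> 12 * l"
proof -
  define k where "k = \<lfloor>log 4 (3 * l)\<rfloor> + 1"
  have "3 * l = 4 powr (log 4 (3 * l))" using assms by simp
  also have "\<dots> < 4 powr (of_int k)" unfolding k_def by (intro powr_less_mono) linarith+
  also have "\<dots> = 4 powi k" by (simp add: powr_real_of_int')
  finally have 1: "3 * l < 4 powi k" .
  have "4 powi k = (4::real) powr (of_int k)" by (simp add: powr_real_of_int')
  also have "\<dots> \<le> 4 powr (log 4 (3 * l) + 1)" unfolding k_def by (intro powr_mono) linarith+
  also have "\<dots> = 12 * l" using assms by (simp add: powr_add)
  finally show ?thesis using 1 that by blast
qed

text \<open>The shift is chosen separately in each coordinate, which is why there is one grid for
  each \<open>b\<close>, 2^n in all.\<close>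

lemma cube_in_cell:
  fixes a :: "real ^ 'n"
  assumes "0 < l"
  obtains b Q where "cbox a (a + (\<chi> i. l)) \<subseteq> cell b Q" "4 powi fst Q \<le> 12 * l"
proof -
  obtain k where k: "3 * l < 4 powi k" "4 powi k \<le> 12 * l" using exists_scale[OF assms] .
  let ?h = "4 powi k :: real"
  have h: "0 < ?h" by simp
  have "\<exists>c. \<lfloor>a $ i / ?h - of_bool c / 3\<rfloor> = \<lfloor>a $ i / ?h + l / ?h - of_bool c / 3\<rfloor>" for i
    using k assms h by (intro exists_shifted_cell_1d) (auto simp: field_simps)
  then obtain b where b: "\<And>i. \<lfloor>a $ i / ?h - of_bool (b i) / 3\<rfloor> = \<lfloor>a $ i / ?h + l / ?h - of_bool (b i) / 3\<rfloor>"
    by metis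
  define Q where "Q = (k, \<lambda>i. \<lfloor>a $ i / ?h - of_bool (b i) / 3\<rfloor>)"
  have "cbox a (a + (\<chi> i. l)) \<subseteq> cell b Q"
  proof
    fix x assume x: "x \<in> cbox a (a + (\<chi> i. l))"
    have "\<lfloor>x $ i / ?h - of_bool (b i) / 3\<rfloor> = \<lfloor>a $ i / ?h - of_bool (b i) / 3\<rfloor>" for i
    proof (rule antisym)
      have "a $ i \<le> x $ i" "x $ i \<le> a $ i + l" using x by (auto simp: mem_box_cart)
      then have "a $ i / ?h \<le> x $ i / ?h" "x $ i / ?h \<le> a $ i / ?h + l / ?h"
        using h by (auto simp: divide_right_mono simp flip: add_divide_distrib)
      then have "\<lfloor>x $ i / ?h - of_bool (b i) / 3\<rfloor> \<le> \<lfloor>a $ i / ?h + l / ?h - of_bool (b i) / 3\<rfloor>"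
        and le: "\<lfloor>a $ i / ?h - of_bool (b i) / 3\<rfloor> \<le> \<lfloor>x $ i / ?h - of_bool (b i) / 3\<rfloor>"
        by (intro floor_mono; linarith)+
      then show "\<lfloor>x $ i / ?h - of_bool (b i) / 3\<rfloor> \<le> \<lfloor>a $ i / ?h - of_bool (b i) / 3\<rfloor>"
        by (simp only: b)
      show "\<lfloor>a $ i / ?h - of_bool (b i) / 3\<rfloor> \<le> \<lfloor>x $ i / ?h - of_bool (b i) / 3\<rfloor>" by (rule le)
    qed
    then show "x \<in> cell b Q" by (simp add: cell_def Q_def)
  qed
  moreover have "4 powi fst Q \<le> 12 * l" using k by (simp add: Q_def)
  ultimately show ?thesis using that by blast
qed

section \<open>The testing condition\<close>

lemma prod_mono_ennreal:
  fixes f g :: "'i \<Rightarrow> ennreal"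
  shows "(\<And>i. i \<in> I \<Longrightarrow> f i \<le> g i) \<Longrightarrow> prod f I \<le> prod g I"
  by (induction I rule: infinite_finite_induct) (auto intro!: mult_mono)

lemma nn_integral_null_diff:
  assumes "H \<subseteq> C" "C - H \<in> null_sets M"
  shows "(\<integral>\<^sup>+x\<in>C. f x \<partial>M) = (\<integral>\<^sup>+x\<in>H. f x \<partial>M)"
proof (rule nn_integral_cong_AE)
  show "AE x in M. f x * indicator C x = f x * indicator H x"
    using AE_not_in[OF assms(2)] by eventually_elim (use assms(1) in \<open>auto simp: indicator_def\<close>)
qed

lemma dual_weight_nonneg: "0 \<le> dual_weight r w x"
  by (simp add: dual_weight_def)

text \<open>All three rest on (1 - r')(1 - r) = 1. The second computes the norm of the test function
  sigma on a cube; the third lets functions be written as multiples of sigma.\<close>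

lemma dual_weight_identities:
  assumes "1 < r" "0 < w x"
  shows "0 < dual_weight r w x"
    and "dual_weight r w x powr r * w x = dual_weight r w x"
    and "dual_weight r w x powr (1 - r) = w x"
proof -
  have e: "(1 - conj_exponent r) * (1 - r) = 1" "(1 - conj_exponent r) * r + 1 = 1 - conj_exponent r"
    using assms(1) by (auto simp: conj_exponent_def field_simps)
  show "0 < dual_weight r w x" using assms by (simp add: dual_weight_def)
  have "dual_weight r w x powr r * w x = w x powr ((1 - conj_exponent r) * r + 1)"
    using assms by (simp add: dual_weight_def powr_powr powr_add)
  then show "dual_weight r w x powr r * w x = dual_weight r w x"
    by (simp only: e dual_weight_def)
  have "dual_weight r w x powr (1 - r) = w x powr ((1 - conj_exponent r) * (1 - r))"
    by (simp add: dual_weight_def powr_powr)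
  then show "dual_weight r w x powr (1 - r) = w x"
    using assms by (simp only: e powr_one)
qed

text \<open>The \<open>\<sigma>\<close> are assumed to be weights only. Bounds for their A_infinity
  constants are left to the individual lemmas as an explicit \<open>B\<close>, so that the
  dependence of the final constant can be read off.\<close>

locale maximal_setting =
  fixes m :: nat and \<alpha> p q :: real and P :: "nat \<Rightarrow> real"
    and \<omega> :: "nat \<Rightarrow> real ^ 'n \<Rightarrow> real" and v :: "real ^ 'n \<Rightarrow> real"
  assumes m: "1 \<le> m" and P: "\<And>i. i \<in> {1..m} \<Longrightarrow> 1 < P i"
    and \<alpha>: "0 \<le> \<alpha>"
    and p: "1 / p = (\<Sum>i\<in>{1..m}. 1 / P i)" and pq: "p \<le> q"
    and weight_\<omega>: "\<And>i. i \<in> {1..m} \<Longrightarrow> weight (\<omega> i)" and weight_v: "weight v"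
    and weight_\<sigma>: "\<And>i. i \<in> {1..m} \<Longrightarrow> weight (dual_weight (P i) (\<omega> i))"
begin

abbreviation \<sigma> :: "nat \<Rightarrow> real ^ 'n \<Rightarrow> real" where
  "\<sigma> i \<equiv> dual_weight (P i) (\<omega> i)"

definition mass :: "nat \<Rightarrow> (real ^ 'n) set \<Rightarrow> real" where
  "mass i C = enn2real (weight_mass (\<sigma> i) C)"

text \<open>The term of M_alpha belonging to the cube \<open>C\<close> when every f_i is sigma_i.
  For general f this factor splits off, leaving sigma_i-averages.\<close>

definition \<beta> :: "(real ^ 'n) set \<Rightarrow> real" where
  "\<beta> C = measure lebesgue C powr (\<alpha> / real CARD('n)) * (\<Prod>i\<in>{1..m}. mass i C / measure lebesgue C)"

lemma p_pos: "0 < p"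
proof -
  have "0 < (\<Sum>i\<in>{1..m}. 1 / P i)"
    using m P by (intro sum_pos) (force simp: less_trans[OF zero_less_one])+
  then show ?thesis using p by (metis zero_less_divide_1_iff)
qed

lemma q_pos: "0 < q"
  using p_pos pq by simp

lemma P_pos: "i \<in> {1..m} \<Longrightarrow> 0 < P i"
  using P by fastforce

lemma sum_exponents: "(\<Sum>i\<in>{1..m}. p / P i) = 1"
proof -
  have "(\<Sum>i\<in>{1..m}. p / P i) = p * (1 / p)" unfolding p by (simp add: sum_distrib_left)
  then show ?thesis using p_pos by simp
qed

lemma mass_eq: "i \<in> {1..m} \<Longrightarrow> C \<in> cubes \<Longrightarrow> weight_mass (\<sigma> i) C = ennreal (mass i C)"
  using weight_mass_finite[OF weight_\<sigma>] by (simp add: mass_def)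

lemma mass_pos: "i \<in> {1..m} \<Longrightarrow> C \<in> cubes \<Longrightarrow> 0 < mass i C"
  using weight_mass_finite[OF weight_\<sigma>] weight_mass_pos[OF weight_\<sigma>]
  by (simp add: mass_def enn2real_positive_iff)

lemma mass_nonneg: "0 \<le> mass i C"
  by (simp add: mass_def)

lemma \<beta>_nonneg: "0 \<le> \<beta> C"
  by (auto simp: \<beta>_def mass_def intro!: mult_nonneg_nonneg prod_nonneg)

lemma AE_\<sigma>:
  assumes "i \<in> {1..m}"
  shows "AE x in lebesgue. 0 < \<omega> i x \<and> 0 < \<sigma> i x"
proof -
  have "AE x in lebesgue. 0 < \<omega> i x" using weight_\<omega>[OF assms] by (simp add: weight_def)
  then show ?thesis
    by eventually_elim (use dual_weight_identities(1) P[OF assms] in auto)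
qed

lemma testing_bound:
  assumes S: "S_const m \<alpha> P q \<omega> v \<le> ennreal S" "0 \<le> S" and R: "R \<in> cubes"
  shows "(\<integral>\<^sup>+x\<in>R. epowr (max_op m \<alpha> (\<lambda>i y. \<sigma> i y * indicator R y) x) q * ennreal (v x) \<partial>lebesgue)
    \<le> ennreal (S powr q * (\<Prod>i\<in>{1..m}. mass i R powr (q / P i)))"
    (is "?X \<le> _")
proof -
  let ?D = "\<Prod>i\<in>{1..m}. mass i R powr (1 / P i)"
  have D: "0 < ?D" using mass_pos[OF _ R] by (intro prod_pos) (auto simp: order.strict_iff_order)
  have "(\<Prod>i\<in>{1..m}. epowr (weight_mass (\<sigma> i) R) (1 / P i)) = ennreal ?D"
  proof -
    have "(\<Prod>i\<in>{1..m}. epowr (weight_mass (\<sigma> i) R) (1 / P i)) = (\<Prod>i\<in>{1..m}. epowr (ennreal (mass i R)) (1 / P i))"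
      using mass_eq[OF _ R] by (intro prod.cong refl) simp
    then show ?thesis by (simp only: prod_epowr_ennreal[OF mass_nonneg])
  qed
  moreover have "epowr ?X (1 / q) / (\<Prod>i\<in>{1..m}. epowr (weight_mass (\<sigma> i) R) (1 / P i)) \<le> S_const m \<alpha> P q \<omega> v"
    unfolding S_const_def Let_def by (rule SUP_upper[OF R])
  ultimately have "epowr ?X (1 / q) / ennreal ?D \<le> ennreal S" using S(1) by simp
  then have "epowr ?X (1 / q) / ennreal ?D * ennreal ?D \<le> ennreal S * ennreal ?D"
    by (rule mult_right_mono) simp
  also have "epowr ?X (1 / q) / ennreal ?D * ennreal ?D = epowr ?X (1 / q)"
  proof -
    have "ennreal ?D / ennreal ?D = 1"
      using D by (intro ennreal_divide_self) (simp_all only: ennreal_eq_0_iff not_le ennreal_less_top)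
    then show ?thesis by (simp only: ennreal_divide_times mult_1_right)
  qed
  also have "ennreal S * ennreal ?D = ennreal (S * ?D)" using S(2) D by (simp add: ennreal_mult)
  finally have "?X \<le> epowr (ennreal (S * ?D)) q" using q_pos by (simp add: epowr_le_iff)
  also have "\<dots> = ennreal (S powr q * (\<Prod>i\<in>{1..m}. mass i R powr (q / P i)))"
    using S(2) D by (simp add: epowr_ennreal powr_mult prod_powr_powr mult.commute)
  finally show ?thesis .
qed

text \<open>\<open>Q\<close> competes in the supremum for the truncated functions. Truncation to
  \<open>R\<close> costs nothing: \<open>R\<close> contains \<open>H\<close>, and \<open>H\<close>
  fills \<open>Q\<close> up to a null set.\<close>

lemma \<beta>_le_max_op:
  assumes Q: "Q \<in> cubes" "H \<subseteq> Q" "Q - H \<in> null_sets lebesgue" "x \<in> Q" and "H \<subseteq> R"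
  shows "ennreal (\<beta> Q) \<le> max_op m \<alpha> (\<lambda>i y. \<sigma> i y * indicator R y) x"
proof -
  let ?V = "measure lebesgue Q"
  have V: "0 < ?V" using cube_measure_pos[OF Q(1)] .
  have "ennreal (\<beta> Q) = ennreal (?V powr (\<alpha> / real CARD('n))) * (\<Prod>i\<in>{1..m}. ennreal (mass i Q / ?V))"
    using V by (simp add: \<beta>_def ennreal_mult prod_ennreal mass_def prod_nonneg)
  also have "\<dots> \<le> ennreal (?V powr (\<alpha> / real CARD('n))) * (\<Prod>i\<in>{1..m}. indicator Q x / emeasure lebesgue Q *
      (\<integral>\<^sup>+y\<in>Q. ennreal \<bar>\<sigma> i y * indicator R y\<bar> \<partial>lebesgue))"
  proof (intro mult_left_mono prod_mono_ennreal)
    fix i assume i: "i \<in> {1..m}"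
    have "ennreal (mass i Q / ?V) = 1 / ennreal ?V * ennreal (mass i Q)"
      using V mass_pos[OF i Q(1)] by (simp add: divide_ennreal ennreal_divide_times)
    also have "ennreal (mass i Q) = (\<integral>\<^sup>+y\<in>H. ennreal (\<sigma> i y) \<partial>lebesgue)"
      using nn_integral_null_diff[OF Q(2,3)] mass_eq[OF i Q(1)] by (simp add: weight_mass_def)
    also have "\<dots> \<le> (\<integral>\<^sup>+y\<in>Q. ennreal \<bar>\<sigma> i y * indicator R y\<bar> \<partial>lebesgue)"
      using Q(2) \<open>H \<subseteq> R\<close> by (intro nn_integral_mono) (auto simp: indicator_def dual_weight_nonneg)
    finally show "ennreal (mass i Q / ?V) \<le> indicator Q x / emeasure lebesgue Q *
      (\<integral>\<^sup>+y\<in>Q. ennreal \<bar>\<sigma> i y * indicator R y\<bar> \<partial>lebesgue)"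
      using Q(4) cube_emeasure[OF Q(1)] by (simp add: mult_left_mono)
  qed simp
  also have "\<dots> \<le> max_op m \<alpha> (\<lambda>i y. \<sigma> i y * indicator R y) x"
    unfolding max_op_def by (rule SUP_upper[OF Q(1)])
  finally show ?thesis .
qed

text \<open>For every \<open>Q\<close> below \<open>R\<close> the number
  \<open>\<beta> (C Q)\<close> is attained by the same function M_alpha(sigma chi_R) as a lower
  bound on \<open>E Q\<close>. The pieces are disjoint, so a single test on \<open>R\<close>
  controls the whole sum.\<close>

lemma testing_packing:
  fixes C H E :: "'i \<Rightarrow> (real ^ 'n) set"
  assumes S: "S_const m \<alpha> P q \<omega> v \<le> ennreal S" "0 \<le> S"
    and G: "finite G" "disjoint_family_on E G" "\<And>Q. Q \<in> G \<Longrightarrow> E Q \<in> sets lebesgue" "\<And>Q. Q \<in> G \<Longrightarrow> E Q \<subseteq> H Q"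
    and C: "\<And>Q. Q \<in> G \<Longrightarrow> C Q \<in> cubes" "\<And>Q. Q \<in> G \<Longrightarrow> H Q \<subseteq> C Q" "\<And>Q. Q \<in> G \<Longrightarrow> C Q - H Q \<in> null_sets lebesgue"
    and R: "R \<in> cubes" "\<And>Q. Q \<in> G \<Longrightarrow> H Q \<subseteq> R"
  shows "(\<Sum>Q\<in>G. ennreal (\<beta> (C Q) powr q) * (\<integral>\<^sup>+x\<in>E Q. ennreal (v x) \<partial>lebesgue))
    \<le> ennreal (S powr q * (\<Prod>i\<in>{1..m}. mass i R powr (q / P i)))"
proof -
  note [measurable] = weight_measurable[OF weight_v]
  have "(\<Sum>Q\<in>G. ennreal (\<beta> (C Q) powr q) * (\<integral>\<^sup>+x\<in>E Q. ennreal (v x) \<partial>lebesgue))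
      = (\<integral>\<^sup>+x. (\<Sum>Q\<in>G. ennreal (\<beta> (C Q) powr q) * (ennreal (v x) * indicator (E Q) x)) \<partial>lebesgue)"
    using G(3) by (simp add: nn_integral_sum nn_integral_cmult)
  also have "\<dots> \<le> (\<integral>\<^sup>+x\<in>R. epowr (max_op m \<alpha> (\<lambda>i y. \<sigma> i y * indicator R y) x) q * ennreal (v x) \<partial>lebesgue)"
  proof (rule nn_integral_mono)
    fix x
    have e: "(\<Sum>Q\<in>G. ennreal (\<beta> (C Q) powr q) * (ennreal (v x) * indicator (E Q) x))
        = (\<Sum>Q\<in>G. ennreal (\<beta> (C Q) powr q) * ennreal (v x) * indicator (E Q) x)"
      by (simp add: mult.assoc)
    show "(\<Sum>Q\<in>G. ennreal (\<beta> (C Q) powr q) * (ennreal (v x) * indicator (E Q) x))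
        \<le> epowr (max_op m \<alpha> (\<lambda>i y. \<sigma> i y * indicator R y) x) q * ennreal (v x) * indicator R x"
    proof (cases "\<exists>Q\<in>G. x \<in> E Q")
      case True
      then obtain Q where Q: "Q \<in> G" "x \<in> E Q" by auto
      then have x: "x \<in> H Q" "x \<in> C Q" "x \<in> R" using G(4) C(2) R(2) by blast+
      have "ennreal (\<beta> (C Q) powr q) = epowr (ennreal (\<beta> (C Q))) q"
        by (simp add: epowr_ennreal \<beta>_nonneg)
      also have "\<dots> \<le> epowr (max_op m \<alpha> (\<lambda>i y. \<sigma> i y * indicator R y) x) q"
        using q_pos C Q x R by (intro epowr_mono \<beta>_le_max_op[of _ "H Q"]) auto
      finally show ?thesis using x
        unfolding e sum_indicator_disjoint[OF G(1,2) Q] by (simp add: mult_right_mono)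
    next
      case False
      then have "(\<Sum>Q\<in>G. ennreal (\<beta> (C Q) powr q) * (ennreal (v x) * indicator (E Q) x)) = 0"
        by (intro sum.neutral) auto
      then show ?thesis by simp
    qed
  qed
  also note testing_bound[OF S R(1)]
  finally show ?thesis .
qed

section \<open>Boundedness on a finite laminar family of cubes\<close>

definition avg :: "(nat \<Rightarrow> real ^ 'n \<Rightarrow> real) \<Rightarrow> (real ^ 'n) set \<Rightarrow> real" where
  "avg f C = measure lebesgue C powr (\<alpha> / real CARD('n)) *
     (\<Prod>i\<in>{1..m}. enn2real (\<integral>\<^sup>+x\<in>C. ennreal \<bar>f i x\<bar> \<partial>lebesgue) / measure lebesgue C)"

lemma avg_nonneg: "0 \<le> avg f C"
  by (auto simp: avg_def intro!: mult_nonneg_nonneg prod_nonneg)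

text \<open>With |h| = g sigma_i, the norm of h in L^P(omega_i) is that of g in L^P(sigma_i); this
  moves the problem to the measures sigma_i dx.\<close>

lemma AE_quotient_identity:
  assumes "i \<in> {1..m}"
  shows "AE x in lebesgue. \<sigma> i x * (\<bar>h x\<bar> / \<sigma> i x) = \<bar>h x\<bar> \<and> \<sigma> i x * (\<bar>h x\<bar> / \<sigma> i x) powr P i = \<bar>h x\<bar> powr P i * \<omega> i x"
  using AE_\<sigma>[OF assms]
proof eventually_elim
  case (elim x)
  have "\<sigma> i x * (\<bar>h x\<bar> / \<sigma> i x) powr P i = \<bar>h x\<bar> powr P i * (\<sigma> i x / \<sigma> i x powr P i)"
    using elim by (simp add: powr_divide)
  also have "\<sigma> i x / \<sigma> i x powr P i = \<sigma> i x powr (1 - P i)" using elim by (simp add: powr_diff)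
  also have "\<dots> = \<omega> i x" using dual_weight_identities(3)[of "P i" "\<omega> i" x] P[OF assms] elim by simp
  finally show ?case using elim by simp
qed

text \<open>With |h| = sigma y, the bound y <= y^P + 1 integrated against sigma leaves the finite
  norm integral plus the finite mass of \<open>C\<close>.\<close>

lemma Lp_space_integral_finite:
  assumes "i \<in> {1..m}" "h \<in> Lp_space (P i) (\<omega> i)" "C \<in> cubes"
  shows "(\<integral>\<^sup>+x\<in>C. ennreal \<bar>h x\<bar> \<partial>lebesgue) < \<infinity>"
proof -
  note [measurable] = weight_measurable[OF weight_\<sigma>[OF assms(1)]] weight_measurable[OF weight_\<omega>[OF assms(1)]] cube_sets[OF assms(3)]
  have [measurable]: "h \<in> borel_measurable lebesgue" using assms(2) by (simp add: Lp_space_def)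
  have le: "y \<le> y powr P i + 1" if "0 \<le> y" for y :: real
  proof (cases "y \<le> 1")
    case False
    then have "y powr 1 \<le> y powr P i" using P[OF assms(1)] by (intro powr_mono) auto
    then show ?thesis using False by simp
  qed (simp add: add_increasing)
  have "(\<integral>\<^sup>+x\<in>C. ennreal \<bar>h x\<bar> \<partial>lebesgue)
      \<le> (\<integral>\<^sup>+x. ennreal (\<bar>h x\<bar> powr P i) * ennreal (\<omega> i x) + ennreal (\<sigma> i x) * indicator C x \<partial>lebesgue)"
  proof (rule nn_integral_mono_AE)
    show "AE x in lebesgue. ennreal \<bar>h x\<bar> * indicator C x
        \<le> ennreal (\<bar>h x\<bar> powr P i) * ennreal (\<omega> i x) + ennreal (\<sigma> i x) * indicator C x"
      using AE_quotient_identity[OF assms(1), of h] AE_\<sigma>[OF assms(1)]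
    proof eventually_elim
      case (elim x)
      have "\<bar>h x\<bar> = \<sigma> i x * (\<bar>h x\<bar> / \<sigma> i x)" using elim by simp
      also have "\<dots> \<le> \<sigma> i x * ((\<bar>h x\<bar> / \<sigma> i x) powr P i + 1)"
        using elim by (intro mult_left_mono le) auto
      also have "\<dots> = \<bar>h x\<bar> powr P i * \<omega> i x + \<sigma> i x" using elim by (simp add: distrib_left)
      finally have "ennreal \<bar>h x\<bar> \<le> ennreal (\<bar>h x\<bar> powr P i) * ennreal (\<omega> i x) + ennreal (\<sigma> i x)"
        using elim by (simp add: ennreal_leI flip: ennreal_mult ennreal_plus)
      then show ?case by (auto simp: indicator_def)
    qed
  qed
  also have "\<dots> = (\<integral>\<^sup>+x. ennreal (\<bar>h x\<bar> powr P i) * ennreal (\<omega> i x) \<partial>lebesgue) + weight_mass (\<sigma> i) C"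
    unfolding weight_mass_def by (intro nn_integral_add) auto
  also have "\<dots> < \<infinity>"
    using assms(2) weight_mass_finite[OF weight_\<sigma>[OF assms(1)] assms(3)] by (simp add: Lp_space_def)
  finally show ?thesis .
qed

text \<open>Origin of the constant: q/p is the Carleson factor, \<open>B\<close> to the power q/p
  comes from comparing masses with nu, the product from the maximal inequality for each sigma_i, and
  \<open>S\<close> to the power q from testing.\<close>

lemma finite_laminar_bound:
  fixes C H :: "'i \<Rightarrow> (real ^ 'n) set" and N :: "nat \<Rightarrow> real"
  assumes S: "S_const m \<alpha> P q \<omega> v \<le> ennreal S" "0 \<le> S"
    and B: "\<And>i. i \<in> {1..m} \<Longrightarrow> A_infty_const (\<sigma> i) \<le> ennreal B" "0 < B"
    and F: "finite F" "laminar_on H F" "\<And>Q. Q \<in> F \<Longrightarrow> H Q \<in> sets lebesgue"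
    and C: "\<And>Q. Q \<in> F \<Longrightarrow> C Q \<in> cubes" "\<And>Q. Q \<in> F \<Longrightarrow> H Q \<subseteq> C Q" "\<And>Q. Q \<in> F \<Longrightarrow> C Q - H Q \<in> null_sets lebesgue"
    and f: "\<And>i. i \<in> {1..m} \<Longrightarrow> f i \<in> Lp_space (P i) (\<omega> i)"
    and N: "\<And>i. i \<in> {1..m} \<Longrightarrow> 0 < N i"
      "\<And>i. i \<in> {1..m} \<Longrightarrow> (\<integral>\<^sup>+x. ennreal (\<bar>f i x\<bar> powr P i) * ennreal (\<omega> i x) \<partial>lebesgue) \<le> ennreal (N i)"
  shows "(\<integral>\<^sup>+x. (SUP Q\<in>F. ennreal (avg f (C Q) powr q) * indicator (H Q) x) * ennreal (v x) \<partial>lebesgue)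
    \<le> ennreal (q / p * B powr (q / p) * (\<Prod>i\<in>{1..m}. ((2 * P i / (P i - 1)) powr P i * 2) powr (q / P i))
         * S powr q * (\<Prod>i\<in>{1..m}. N i powr (q / P i)))"
proof -
  let ?I = "{1..m}" and ?K = "\<lambda>i. (2 * P i / (P i - 1)) powr P i * 2" and ?\<theta> = "\<lambda>i. p / P i"
  note [measurable] = weight_measurable[OF weight_v]
  have \<sigma>m [measurable]: "\<And>i. i \<in> ?I \<Longrightarrow> \<sigma> i \<in> borel_measurable lebesgue" using weight_measurable[OF weight_\<sigma>] by simp
  have fm [measurable]: "\<And>i. i \<in> ?I \<Longrightarrow> f i \<in> borel_measurable lebesgue" using f by (simp add: Lp_space_def)
  have \<theta>: "\<And>i. i \<in> ?I \<Longrightarrow> 0 < ?\<theta> i" "sum ?\<theta> ?I = 1"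
    using P_pos p_pos sum_exponents by auto
  define M where "M i = density lebesgue (\<lambda>x. ennreal (\<sigma> i x))" for i
  define \<phi> where "\<phi> i Q = enn2real (\<integral>\<^sup>+x\<in>C Q. ennreal \<bar>f i x\<bar> \<partial>lebesgue)" for i Q
  \<comment> \<open>The average over \<open>C Q\<close> of |f_i|/sigma_i with respect to sigma_i
    dx.\<close>
  define a where "a i Q = \<phi> i Q / mass i (C Q)" for i Q
  define g where "g i x = \<bar>f i x\<bar> / \<sigma> i x" for i x
  have gm [measurable]: "\<And>i. i \<in> ?I \<Longrightarrow> g i \<in> borel_measurable lebesgue" unfolding g_def by measurable
  have a0: "0 \<le> a i Q" for i Q by (simp add: a_def \<phi>_def mass_nonneg)
  have \<phi>: "(\<integral>\<^sup>+x\<in>H Q. ennreal \<bar>f i x\<bar> \<partial>lebesgue) = ennreal (\<phi> i Q)" if "i \<in> ?I" "Q \<in> F" for i Q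
    using Lp_space_integral_finite[OF that(1) f[OF that(1)] C(1)[OF that(2)]] nn_integral_null_diff[OF C(2,3)[OF that(2)]]
    by (simp add: \<phi>_def)
  have massH: "(\<integral>\<^sup>+x\<in>H Q. ennreal (\<sigma> i x) \<partial>lebesgue) = ennreal (mass i (C Q))" if "i \<in> ?I" "Q \<in> F" for i Q
    using mass_eq[OF that(1) C(1)[OF that(2)]] nn_integral_null_diff[OF C(2,3)[OF that(2)], of "\<lambda>x. ennreal (\<sigma> i x)"]
    by (simp add: weight_mass_def)
  have "\<exists>A. A \<in> borel_measurable lebesgue \<and> (\<forall>x. 0 \<le> A x) \<and> (\<forall>Q\<in>F. \<forall>x\<in>H Q. a i Q \<le> A x) \<and>
      (\<integral>\<^sup>+x. ennreal (A x powr P i * \<sigma> i x) \<partial>lebesgue) \<le> ennreal (?K i * N i)" if i: "i \<in> ?I" for i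
  proof -
    note [measurable] = \<sigma>m[OF i] fm[OF i] gm[OF i]
    obtain A where A: "A \<in> borel_measurable (M i)" "\<And>x. 0 \<le> A x"
      "\<And>Q x. Q \<in> F \<Longrightarrow> x \<in> H Q \<Longrightarrow> a i Q \<le> A x"
      "(\<integral>\<^sup>+x. ennreal (A x powr P i) \<partial>M i) \<le> ennreal (?K i) * (\<integral>\<^sup>+x. ennreal (g i x powr P i) \<partial>M i)"
    proof (rule laminar_maximal_inequality[of F H "P i" "M i" "g i" "a i"])
      show "H Q \<in> sets (M i)" if "Q \<in> F" for Q using F(3)[OF that] by (simp add: M_def)
      have em: "emeasure (M i) (H Q) = ennreal (mass i (C Q))" if "Q \<in> F" for Q
        using F(3)[OF that] massH[OF i that] by (simp add: M_def emeasure_density)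
      then show "emeasure (M i) (H Q) < \<infinity>" if "Q \<in> F" for Q using that by simp
      show "g i \<in> borel_measurable (M i)" by (simp add: M_def)
      show "0 \<le> g i x" for x by (simp add: g_def dual_weight_nonneg)
      show "ennreal (a i Q) * emeasure (M i) (H Q) \<le> (\<integral>\<^sup>+x\<in>H Q. ennreal (g i x) \<partial>M i)" if Q: "Q \<in> F" for Q
      proof -
        have "ennreal (a i Q) * emeasure (M i) (H Q) = ennreal (\<phi> i Q)"
          using mass_pos[OF i C(1)[OF Q]] a0 by (simp add: em[OF Q] a_def flip: ennreal_mult)
        also have "\<dots> = (\<integral>\<^sup>+x. ennreal (\<sigma> i x) * (ennreal (g i x) * indicator (H Q) x) \<partial>lebesgue)"
          unfolding \<phi>[OF i Q, symmetric]
        proof (rule nn_integral_cong_AE)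
          show "AE x in lebesgue. ennreal \<bar>f i x\<bar> * indicator (H Q) x = ennreal (\<sigma> i x) * (ennreal (g i x) * indicator (H Q) x)"
            using AE_quotient_identity[OF i, of "f i"]
            by eventually_elim (auto simp: g_def mult.assoc[symmetric] dual_weight_nonneg simp flip: ennreal_mult)
        qed
        also note [measurable] = F(3)[OF Q]
        have "(\<integral>\<^sup>+x. ennreal (\<sigma> i x) * (ennreal (g i x) * indicator (H Q) x) \<partial>lebesgue) = (\<integral>\<^sup>+x\<in>H Q. ennreal (g i x) \<partial>M i)"
          unfolding M_def using weight_\<sigma>[OF i] by (intro nn_integral_density[symmetric]) measurable
        finally show ?thesis by simp
      qed
    qed (use F P[OF i] a0 in auto)
    have Am [measurable]: "A \<in> borel_measurable lebesgue" using A(1) by (simp add: M_def)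
    have "(\<integral>\<^sup>+x. ennreal (A x powr P i * \<sigma> i x) \<partial>lebesgue) = (\<integral>\<^sup>+x. ennreal (A x powr P i) \<partial>M i)"
      unfolding M_def by (subst nn_integral_density) (auto simp: ennreal_mult dual_weight_nonneg mult.commute)
    also note A(4)
    also have "(\<integral>\<^sup>+x. ennreal (g i x powr P i) \<partial>M i) = (\<integral>\<^sup>+x. ennreal (\<sigma> i x) * ennreal (g i x powr P i) \<partial>lebesgue)"
      unfolding M_def by (intro nn_integral_density) measurable
    also have "\<dots> = (\<integral>\<^sup>+x. ennreal (\<bar>f i x\<bar> powr P i) * ennreal (\<omega> i x) \<partial>lebesgue)"
    proof (rule nn_integral_cong_AE)
      show "AE x in lebesgue. ennreal (\<sigma> i x) * ennreal (g i x powr P i) = ennreal (\<bar>f i x\<bar> powr P i) * ennreal (\<omega> i x)"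
        using AE_quotient_identity[OF i, of "f i"] AE_\<sigma>[OF i]
        by eventually_elim (simp add: g_def dual_weight_nonneg flip: ennreal_mult)
    qed
    also have "ennreal (?K i) * \<dots> \<le> ennreal (?K i) * ennreal (N i)"
      using N(2)[OF i] by (rule mult_left_mono) simp
    also have "\<dots> = ennreal (?K i * N i)" using N(1)[OF i] by (simp add: ennreal_mult)
    finally show ?thesis using A(2,3) Am by blast
  qed
  then have "\<exists>A. \<forall>i\<in>?I. A i \<in> borel_measurable lebesgue \<and> (\<forall>x. 0 \<le> A i x) \<and> (\<forall>Q\<in>F. \<forall>x\<in>H Q. a i Q \<le> A i x) \<and>
      (\<integral>\<^sup>+x. ennreal (A i x powr P i * \<sigma> i x) \<partial>lebesgue) \<le> ennreal (?K i * N i)"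
    by (intro bchoice ballI)
  then obtain A where A: "\<forall>i\<in>?I. A i \<in> borel_measurable lebesgue \<and> (\<forall>x. 0 \<le> A i x) \<and> (\<forall>Q\<in>F. \<forall>x\<in>H Q. a i Q \<le> A i x) \<and>
      (\<integral>\<^sup>+x. ennreal (A i x powr P i * \<sigma> i x) \<partial>lebesgue) \<le> ennreal (?K i * N i)" ..
  have Am [measurable]: "\<And>i. i \<in> ?I \<Longrightarrow> A i \<in> borel_measurable lebesgue"
    and A0: "\<And>i x. i \<in> ?I \<Longrightarrow> 0 \<le> A i x"
    and A_ge: "\<And>i Q x. i \<in> ?I \<Longrightarrow> Q \<in> F \<Longrightarrow> x \<in> H Q \<Longrightarrow> a i Q \<le> A i x"
    and A_int: "\<And>i. i \<in> ?I \<Longrightarrow> (\<integral>\<^sup>+x. ennreal (A i x powr P i * \<sigma> i x) \<partial>lebesgue) \<le> ennreal (?K i * N i)"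
    using A by blast+
  define \<nu> where "\<nu> x = (\<Prod>i\<in>?I. \<sigma> i x powr ?\<theta> i)" for x
  have \<nu>m [measurable]: "\<nu> \<in> borel_measurable lebesgue" unfolding \<nu>_def by measurable
  define V where "V = density lebesgue (\<lambda>x. ennreal (\<nu> x))"
  have \<nu>H: "emeasure V (H Q) = (\<integral>\<^sup>+x\<in>H Q. ennreal (\<nu> x) \<partial>lebesgue)" if "Q \<in> F" for Q
    using F(3)[OF that] by (simp add: V_def emeasure_density)
  \<comment> \<open>Hoelder in the easy direction, with the indicator distributed over the nonempty
    product.\<close>
  have \<nu>H_fin: "emeasure V (H Q) < \<infinity>" if Q: "Q \<in> F" for Q
  proof -
    note [measurable] = F(3)[OF Q]
    have "emeasure V (H Q) = (\<integral>\<^sup>+x. ennreal (\<Prod>i\<in>?I. (\<sigma> i x * indicator (H Q) x) powr ?\<theta> i) \<partial>lebesgue)"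
      unfolding \<nu>H[OF Q] using m by (intro nn_integral_cong) (auto simp: \<nu>_def indicator_def)
    also have "\<dots> \<le> ennreal (\<Prod>i\<in>?I. mass i (C Q) powr ?\<theta> i)"
    proof (rule nn_integral_prod_powr_le[OF _ \<theta>])
      show "(\<integral>\<^sup>+x. ennreal (\<sigma> i x * indicator (H Q) x) \<partial>lebesgue) \<le> ennreal (mass i (C Q))" if "i \<in> ?I" for i
        unfolding massH[OF that Q, symmetric] by (intro nn_integral_mono) (auto simp: indicator_def)
      show "0 \<le> \<sigma> i x * indicator (H Q) x" for i x by (simp add: dual_weight_nonneg)
      show "(\<lambda>x. \<sigma> i x * indicator (H Q) x) \<in> borel_measurable lebesgue" if "i \<in> ?I" for i
        using \<sigma>m[OF that] by measurable
    qed (use mass_pos C(1)[OF Q] in auto)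
    finally show ?thesis by (simp add: le_less_trans[OF _ ennreal_less_top])
  qed
  have prod_mass: "(\<Prod>i\<in>?I. mass i (C Q) powr ?\<theta> i) \<le> B * measure V (H Q)" if Q: "Q \<in> F" for Q
  proof -
    have "ennreal (\<Prod>i\<in>?I. mass i (C Q) powr ?\<theta> i) \<le> ennreal B * (\<integral>\<^sup>+x\<in>C Q. ennreal (\<nu> x) \<partial>lebesgue)"
      unfolding mass_def \<nu>_def using \<theta> C(1)[OF Q] weight_\<sigma> B by (intro A_infty_prod_mass_le) auto
    also have "(\<integral>\<^sup>+x\<in>C Q. ennreal (\<nu> x) \<partial>lebesgue) = ennreal (measure V (H Q))"
      unfolding nn_integral_null_diff[OF C(2,3)[OF Q]] \<nu>H[OF Q, symmetric]
      using \<nu>H_fin[OF Q] by (intro emeasure_eq_ennreal_measure) simp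
    also have "ennreal B * \<dots> = ennreal (B * measure V (H Q))" using B(2) by (simp add: ennreal_mult)
    finally show ?thesis using B(2) by simp
  qed
  obtain E where E: "\<And>Q. Q \<in> F \<Longrightarrow> E Q \<in> sets lebesgue" "\<And>Q. Q \<in> F \<Longrightarrow> E Q \<subseteq> H Q"
    "disjoint_family_on E F"
    "\<And>Q x. Q \<in> F \<Longrightarrow> x \<in> H Q \<Longrightarrow> \<exists>R\<in>F. x \<in> E R \<and> avg f (C Q) \<le> avg f (C R)"
    using disjoint_selection[of F H lebesgue "\<lambda>Q. avg f (C Q)", OF F(1,3)] by metis
  define vE where "vE Q = enn2real (\<integral>\<^sup>+x\<in>E Q. ennreal (v x) \<partial>lebesgue)" for Q
  have vE: "(\<integral>\<^sup>+x\<in>E Q. ennreal (v x) \<partial>lebesgue) = ennreal (vE Q)" if "Q \<in> F" for Q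
  proof -
    have "(\<integral>\<^sup>+x\<in>E Q. ennreal (v x) \<partial>lebesgue) \<le> weight_mass v (C Q)"
      unfolding weight_mass_def using E(2)[OF that] C(2)[OF that] by (intro nn_integral_mono) (auto simp: indicator_def)
    then show ?thesis unfolding vE_def using weight_mass_finite[OF weight_v C(1)[OF that]]
      by (subst ennreal_enn2real) (auto intro: le_less_trans)
  qed
  have vE0: "0 \<le> vE Q" for Q by (simp add: vE_def)
  define \<gamma> where "\<gamma> Q = \<beta> (C Q) powr q * vE Q" for Q
  \<comment> \<open>The power p makes b^(q/p) the q-th power of the product, and makes the majorant
    prod A_i^p integrable against nu by Hoelder.\<close>
  define b where "b Q = (\<Prod>i\<in>?I. a i Q) powr p" for Q
  have avg_eq: "avg f (C Q) = \<beta> (C Q) * (\<Prod>i\<in>?I. a i Q)" if "Q \<in> F" for Q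
  proof -
    have "(\<Prod>i\<in>?I. \<phi> i Q / measure lebesgue (C Q)) = (\<Prod>i\<in>?I. mass i (C Q) / measure lebesgue (C Q)) * (\<Prod>i\<in>?I. a i Q)"
      unfolding prod.distrib[symmetric]
      using mass_pos[OF _ C(1)[OF that]] by (intro prod.cong refl) (force simp: a_def)
    then show ?thesis unfolding avg_def \<beta>_def \<phi>_def by (simp only: mult.assoc)
  qed
  have prod_a0: "0 \<le> (\<Prod>i\<in>?I. a i Q)" for Q using a0 by (intro prod_nonneg) auto
  have carleson: "(\<Sum>Q\<in>F. \<gamma> Q * b Q powr (q / p))
    \<le> q / p * (S powr q * B powr (q / p)) * (\<Prod>i\<in>?I. (?K i * N i) powr ?\<theta> i) powr (q / p)"
  proof (rule laminar_Carleson_embedding[OF F(1,2), where M = V and B = "\<lambda>x. ennreal (\<Prod>i\<in>?I. A i x powr p)"])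
    show "1 \<le> q / p" using pq p_pos by simp
    show "H Q \<in> sets V" if "Q \<in> F" for Q using F(3)[OF that] by (simp add: V_def)
    show "emeasure V (H Q) < \<infinity>" if "Q \<in> F" for Q by (rule \<nu>H_fin[OF that])
    show "0 \<le> b Q" for Q by (simp add: b_def)
    show "0 \<le> \<gamma> Q" for Q by (simp add: \<gamma>_def vE0)
    show "0 \<le> S powr q * B powr (q / p)" by simp
    show "0 \<le> (\<Prod>i\<in>?I. (?K i * N i) powr ?\<theta> i)" by (intro prod_nonneg) auto
    show "ennreal (b Q) \<le> ennreal (\<Prod>i\<in>?I. A i x powr p)" if "Q \<in> F" "x \<in> H Q" for Q x
    proof (rule ennreal_leI)
      have "b Q = (\<Prod>i\<in>?I. a i Q powr p)"
        unfolding b_def by (rule prod_powr_distrib)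
      also have "\<dots> \<le> (\<Prod>i\<in>?I. A i x powr p)"
        using A_ge that a0 p_pos by (intro prod_mono conjI powr_mono2) auto
      finally show "b Q \<le> (\<Prod>i\<in>?I. A i x powr p)" .
    qed
    show "(\<integral>\<^sup>+x. ennreal (\<Prod>i\<in>?I. A i x powr p) \<partial>V) \<le> ennreal (\<Prod>i\<in>?I. (?K i * N i) powr ?\<theta> i)"
    proof -
      have "(\<integral>\<^sup>+x. ennreal (\<Prod>i\<in>?I. A i x powr p) \<partial>V) = (\<integral>\<^sup>+x. ennreal (\<nu> x) * ennreal (\<Prod>i\<in>?I. A i x powr p) \<partial>lebesgue)"
        unfolding V_def by (intro nn_integral_density) measurable
      also have "\<dots> = (\<integral>\<^sup>+x. ennreal (\<Prod>i\<in>?I. (A i x powr P i * \<sigma> i x) powr ?\<theta> i) \<partial>lebesgue)"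
      proof (rule nn_integral_cong)
        fix x
        \<comment> \<open>Factor by factor A^p sigma^(p/P) = (A^P sigma)^(p/P), which is the form
          Hoelder needs.\<close>
        have "\<nu> x * (\<Prod>i\<in>?I. A i x powr p) = (\<Prod>i\<in>?I. (A i x powr P i * \<sigma> i x) powr ?\<theta> i)"
          unfolding \<nu>_def prod.distrib[symmetric] using P_pos dual_weight_nonneg A0
          by (intro prod.cong refl) (force simp: powr_mult powr_powr mult.commute)
        moreover have "0 \<le> \<nu> x" "0 \<le> (\<Prod>i\<in>?I. A i x powr p)" by (auto simp: \<nu>_def intro: prod_nonneg)
        ultimately show "ennreal (\<nu> x) * ennreal (\<Prod>i\<in>?I. A i x powr p) = ennreal (\<Prod>i\<in>?I. (A i x powr P i * \<sigma> i x) powr ?\<theta> i)"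
          by (simp flip: ennreal_mult)
      qed
      also have "\<dots> \<le> ennreal (\<Prod>i\<in>?I. (?K i * N i) powr ?\<theta> i)"
      proof (rule nn_integral_prod_powr_le[OF _ \<theta>])
        show "0 < ?K i * N i" if "i \<in> ?I" for i using P[OF that] N(1)[OF that] by simp
        show "(\<lambda>x. A i x powr P i * \<sigma> i x) \<in> borel_measurable lebesgue" if "i \<in> ?I" for i
          using Am[OF that] \<sigma>m[OF that] by measurable
        show "0 \<le> A i x powr P i * \<sigma> i x" for i x
          by (intro mult_nonneg_nonneg dual_weight_nonneg) auto
      qed (use A_int in auto)
      finally show ?thesis .
    qed
    show "(\<Sum>Q\<in>{Q\<in>F. H Q \<subseteq> H R}. \<gamma> Q) \<le> S powr q * B powr (q / p) * measure V (H R) powr (q / p)" if R: "R \<in> F" for R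
    proof -
      let ?G = "{Q\<in>F. H Q \<subseteq> H R}"
      have "ennreal (\<Sum>Q\<in>?G. \<gamma> Q) = (\<Sum>Q\<in>?G. ennreal (\<beta> (C Q) powr q) * (\<integral>\<^sup>+x\<in>E Q. ennreal (v x) \<partial>lebesgue))"
        using vE vE0 by (simp add: \<gamma>_def ennreal_mult flip: sum_ennreal)
      also have "\<dots> \<le> ennreal (S powr q * (\<Prod>i\<in>?I. mass i (C R) powr (q / P i)))"
      proof (rule testing_packing[where H = H])
        show "disjoint_family_on E ?G" by (rule disjoint_family_on_mono[OF _ E(3)]) auto
        show "H Q \<subseteq> C R" if "Q \<in> ?G" for Q using that C(2)[OF R] by auto
      qed (simp_all add: S F(1) C(1,3) E(1,2) C(2) R)
      finally have "(\<Sum>Q\<in>?G. \<gamma> Q) \<le> S powr q * (\<Prod>i\<in>?I. mass i (C R) powr (q / P i))"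
        by (subst (asm) ennreal_le_iff) (auto intro!: mult_nonneg_nonneg prod_nonneg)
      \<comment> \<open>As q/P_i = (p/P_i)(q/p), the inner product is the one that A_infinity
        compares with nu.\<close>
      also have "(\<Prod>i\<in>?I. mass i (C R) powr (q / P i)) = (\<Prod>i\<in>?I. mass i (C R) powr ?\<theta> i) powr (q / p)"
        using p_pos by (simp add: prod_powr_powr)
      also have "\<dots> \<le> (B * measure V (H R)) powr (q / p)"
        using prod_mass[OF R] p_pos q_pos by (intro powr_mono2 prod_nonneg) auto
      also have "\<dots> = B powr (q / p) * measure V (H R) powr (q / p)" using B(2) by (simp add: powr_mult)
      finally show ?thesis by (simp add: mult_left_mono mult.assoc)
    qed
  qed
  have "(\<integral>\<^sup>+x. (SUP Q\<in>F. ennreal (avg f (C Q) powr q) * indicator (H Q) x) * ennreal (v x) \<partial>lebesgue)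
    \<le> (\<integral>\<^sup>+x. (\<Sum>Q\<in>F. ennreal (avg f (C Q) powr q) * (ennreal (v x) * indicator (E Q) x)) \<partial>lebesgue)"
  proof (rule nn_integral_mono)
    fix x
    have "(SUP Q\<in>F. ennreal (avg f (C Q) powr q) * indicator (H Q) x)
      \<le> (\<Sum>Q\<in>F. ennreal (avg f (C Q) powr q) * indicator (E Q) x)"
    proof (rule SUP_least)
      fix Q assume Q: "Q \<in> F"
      show "ennreal (avg f (C Q) powr q) * indicator (H Q) x \<le> (\<Sum>Q\<in>F. ennreal (avg f (C Q) powr q) * indicator (E Q) x)"
      proof (cases "x \<in> H Q")
        case True
        then obtain R where R: "R \<in> F" "x \<in> E R" "avg f (C Q) \<le> avg f (C R)" using E(4) Q by blast
        then have "ennreal (avg f (C Q) powr q) \<le> ennreal (avg f (C R) powr q)"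
          using avg_nonneg q_pos by (intro ennreal_leI powr_mono2) auto
        then show ?thesis using True by (simp add: sum_indicator_disjoint[OF F(1) E(3) R(1,2)])
      qed simp
    qed
    then have "(SUP Q\<in>F. ennreal (avg f (C Q) powr q) * indicator (H Q) x) * ennreal (v x)
      \<le> (\<Sum>Q\<in>F. ennreal (avg f (C Q) powr q) * indicator (E Q) x) * ennreal (v x)"
      by (rule mult_right_mono) simp
    then show "(SUP Q\<in>F. ennreal (avg f (C Q) powr q) * indicator (H Q) x) * ennreal (v x)
      \<le> (\<Sum>Q\<in>F. ennreal (avg f (C Q) powr q) * (ennreal (v x) * indicator (E Q) x))"
      by (simp add: sum_distrib_right sum_distrib_left mult_ac)
  qed
  also have "\<dots> = (\<Sum>Q\<in>F. ennreal (avg f (C Q) powr q) * (\<integral>\<^sup>+x\<in>E Q. ennreal (v x) \<partial>lebesgue))"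
    using E(1) by (simp add: nn_integral_sum nn_integral_cmult)
  also have "\<dots> = (\<Sum>Q\<in>F. ennreal (\<gamma> Q * b Q powr (q / p)))"
  proof (intro sum.cong refl)
    fix Q assume Q: "Q \<in> F"
    have "avg f (C Q) powr q = \<beta> (C Q) powr q * b Q powr (q / p)"
      using p_pos prod_a0 by (simp add: avg_eq[OF Q] b_def powr_mult \<beta>_nonneg powr_powr)
    then show "ennreal (avg f (C Q) powr q) * (\<integral>\<^sup>+x\<in>E Q. ennreal (v x) \<partial>lebesgue) = ennreal (\<gamma> Q * b Q powr (q / p))"
      using vE0 by (simp add: vE[OF Q] \<gamma>_def mult_ac flip: ennreal_mult)
  qed
  also have "\<dots> = ennreal (\<Sum>Q\<in>F. \<gamma> Q * b Q powr (q / p))"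
    using vE0 by (intro sum_ennreal) (auto simp: \<gamma>_def)
  also have "\<dots> \<le> ennreal (q / p * (S powr q * B powr (q / p)) * (\<Prod>i\<in>?I. (?K i * N i) powr ?\<theta> i) powr (q / p))"
    by (rule ennreal_leI[OF carleson])
  also have "(\<Prod>i\<in>?I. (?K i * N i) powr ?\<theta> i) powr (q / p) = (\<Prod>i\<in>?I. (?K i * N i) powr (q / P i))"
    using p_pos by (simp add: prod_powr_powr)
  also have "\<dots> = (\<Prod>i\<in>?I. ?K i powr (q / P i)) * (\<Prod>i\<in>?I. N i powr (q / P i))"
    unfolding prod.distrib[symmetric] using N(1) by (intro prod.cong refl) (force simp: powr_mult less_imp_le)
  finally show ?thesis by (simp add: mult_ac)
qed

section \<open>Passage to the full maximal function\<close>

definition grid_max :: "(nat \<Rightarrow> real ^ 'n \<Rightarrow> real) \<Rightarrow> ('n \<Rightarrow> bool) \<Rightarrow> real ^ 'n \<Rightarrow> ennreal" where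
  "grid_max f b x = (SUP Q. ennreal (avg f (cell_cube b Q) powr q) * indicator (cell b Q) x)"

text \<open>Each of the m averages loses the volume ratio \<open>k\<close>; the fractional factor
  only grows, because \<alpha> >= 0.\<close>

lemma avg_le_of_subset:
  assumes f: "\<And>i. i \<in> {1..m} \<Longrightarrow> f i \<in> Lp_space (P i) (\<omega> i)"
    and C: "C \<in> cubes" "D \<in> cubes" "C \<subseteq> D" "measure lebesgue D \<le> k * measure lebesgue C"
  shows "avg f C \<le> k ^ m * avg f D"
proof -
  have pos: "0 < measure lebesgue C" "0 < measure lebesgue D" using cube_measure_pos C by auto
  have le: "measure lebesgue C \<le> measure lebesgue D"
    using cube_emeasure[OF C(1)] cube_emeasure[OF C(2)] emeasure_mono[OF C(3) cube_sets[OF C(2)]] by simp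
  have "avg f C \<le> measure lebesgue D powr (\<alpha> / real CARD('n)) *
     (\<Prod>i\<in>{1..m}. k * (enn2real (\<integral>\<^sup>+x\<in>D. ennreal \<bar>f i x\<bar> \<partial>lebesgue) / measure lebesgue D))"
    unfolding avg_def
  proof (intro mult_mono powr_mono2 prod_mono conjI prod_nonneg)
    fix i assume i: "i \<in> {1..m}"
    have "(\<integral>\<^sup>+x\<in>C. ennreal \<bar>f i x\<bar> \<partial>lebesgue) \<le> (\<integral>\<^sup>+x\<in>D. ennreal \<bar>f i x\<bar> \<partial>lebesgue)"
      using C(3) by (intro nn_integral_mono) (auto simp: indicator_def)
    then have 1: "enn2real (\<integral>\<^sup>+x\<in>C. ennreal \<bar>f i x\<bar> \<partial>lebesgue) \<le> enn2real (\<integral>\<^sup>+x\<in>D. ennreal \<bar>f i x\<bar> \<partial>lebesgue)"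
      using Lp_space_integral_finite[OF i f[OF i] C(2)] by (intro enn2real_mono) auto
    have "1 / measure lebesgue C \<le> k / measure lebesgue D" using pos C(4) by (simp add: field_simps)
    with 1 have "enn2real (\<integral>\<^sup>+x\<in>C. ennreal \<bar>f i x\<bar> \<partial>lebesgue) * (1 / measure lebesgue C)
        \<le> enn2real (\<integral>\<^sup>+x\<in>D. ennreal \<bar>f i x\<bar> \<partial>lebesgue) * (k / measure lebesgue D)"
      using pos by (intro mult_mono) auto
    then show "enn2real (\<integral>\<^sup>+x\<in>C. ennreal \<bar>f i x\<bar> \<partial>lebesgue) / measure lebesgue C
        \<le> k * (enn2real (\<integral>\<^sup>+x\<in>D. ennreal \<bar>f i x\<bar> \<partial>lebesgue) / measure lebesgue D)"
      by (simp add: mult.commute)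
  qed (use pos le \<alpha> in auto)
  also have "\<dots> = k ^ m * avg f D"
    unfolding avg_def prod.distrib[of "\<lambda>_. k"] by (simp add: mult_ac)
  finally show ?thesis .
qed

lemma max_op_term:
  assumes f: "\<And>i. i \<in> {1..m} \<Longrightarrow> f i \<in> Lp_space (P i) (\<omega> i)" and C: "C \<in> cubes"
  shows "ennreal (measure lebesgue C powr (\<alpha> / real CARD('n))) *
        (\<Prod>i\<in>{1..m}. indicator C x / emeasure lebesgue C * (\<integral>\<^sup>+y\<in>C. ennreal \<bar>f i y\<bar> \<partial>lebesgue))
     = ennreal (avg f C) * indicator C x"
proof (cases "x \<in> C")
  case True
  have pos: "0 < measure lebesgue C" using cube_measure_pos C by auto
  have "(\<Prod>i\<in>{1..m}. indicator C x / emeasure lebesgue C * (\<integral>\<^sup>+y\<in>C. ennreal \<bar>f i y\<bar> \<partial>lebesgue))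
      = (\<Prod>i\<in>{1..m}. ennreal (enn2real (\<integral>\<^sup>+x\<in>C. ennreal \<bar>f i x\<bar> \<partial>lebesgue) / measure lebesgue C))"
  proof (intro prod.cong refl)
    fix i assume i: "i \<in> {1..m}"
    define y where "y = enn2real (\<integral>\<^sup>+x\<in>C. ennreal \<bar>f i x\<bar> \<partial>lebesgue)"
    have y: "(\<integral>\<^sup>+x\<in>C. ennreal \<bar>f i x\<bar> \<partial>lebesgue) = ennreal y" "0 \<le> y"
      using Lp_space_integral_finite[OF i f[OF i] C] by (auto simp: y_def)
    show "indicator C x / emeasure lebesgue C * (\<integral>\<^sup>+y\<in>C. ennreal \<bar>f i y\<bar> \<partial>lebesgue)
      = ennreal (enn2real (\<integral>\<^sup>+x\<in>C. ennreal \<bar>f i x\<bar> \<partial>lebesgue) / measure lebesgue C)"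
      using True pos y(2) unfolding y(1) cube_emeasure[OF C]
      by (simp add: ennreal_divide_times divide_ennreal)
  qed
  also have "\<dots> = ennreal (\<Prod>i\<in>{1..m}. enn2real (\<integral>\<^sup>+x\<in>C. ennreal \<bar>f i x\<bar> \<partial>lebesgue) / measure lebesgue C)"
    by (intro prod_ennreal) auto
  finally show ?thesis using True by (simp add: avg_def ennreal_mult prod_nonneg)
next
  case False
  \<comment> \<open>The indicator sits inside each factor, so a nonempty product is needed for the
    term to vanish off \<open>C\<close>.\<close>
  then show ?thesis using m by (auto simp: prod_zero_iff)
qed

text \<open>A cube of side l lies in a cell of side at most 12 l, so volumes grow by at most 12^n
  and the m averages lose at most 12^(n m). The shift varies with the cube; summing over all shifts
  gives a bound that can be integrated grid by grid.\<close>

lemma epowr_max_op_le: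
  assumes f: "\<And>i. i \<in> {1..m} \<Longrightarrow> f i \<in> Lp_space (P i) (\<omega> i)"
  shows "epowr (max_op m \<alpha> f x) q \<le> ennreal (((12 ^ CARD('n)) ^ m) powr q) * (\<Sum>b\<in>UNIV. grid_max f b x)"
  unfolding max_op_def
proof (rule epowr_SUP_le[OF q_pos])
  let ?k = "(12 ^ CARD('n)) ^ m :: real"
  fix C :: "(real ^ 'n) set" assume C: "C \<in> cubes"
  show "epowr (ennreal (measure lebesgue C powr (\<alpha> / real CARD('n))) *
        (\<Prod>i\<in>{1..m}. indicator C x / emeasure lebesgue C * (\<integral>\<^sup>+y\<in>C. ennreal \<bar>f i y\<bar> \<partial>lebesgue))) q
     \<le> ennreal (?k powr q) * (\<Sum>b\<in>UNIV. grid_max f b x)"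
  proof (cases "x \<in> C")
    case True
    obtain a l where l: "0 < l" "C = cbox a (a + (\<chi> i. l))" using cubes_obtain[OF C] .
    obtain b Q where Q: "C \<subseteq> cell b Q" "4 powi fst Q \<le> 12 * l"
      using cube_in_cell[OF l(1), of a] unfolding l(2) by metis
    have "measure lebesgue (cell_cube b Q) \<le> (12 * l) ^ CARD('n)"
      unfolding measure_cell_cube using Q(2) by (intro power_mono) auto
    also have "\<dots> = 12 ^ CARD('n) * measure lebesgue C"
      unfolding l(2) measure_cube[OF l(1)] by (simp add: power_mult_distrib)
    finally have "avg f C \<le> ?k * avg f (cell_cube b Q)"
      using Q(1) cell_subset_cube[of b Q] by (intro avg_le_of_subset f C cell_cube_in_cubes) auto
    then have "epowr (ennreal (avg f C)) q \<le> epowr (ennreal (?k * avg f (cell_cube b Q))) q"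
      using q_pos by (intro epowr_mono ennreal_leI) auto
    also have "\<dots> = ennreal (?k powr q) * ennreal (avg f (cell_cube b Q) powr q)"
      by (subst epowr_ennreal) (simp_all add: powr_mult ennreal_mult avg_nonneg)
    also have "ennreal (avg f (cell_cube b Q) powr q) \<le> grid_max f b x"
      unfolding grid_max_def using True Q(1) by (intro SUP_upper2[of Q]) auto
    also have "grid_max f b x \<le> (\<Sum>b\<in>UNIV. grid_max f b x)"
      by (intro member_le_sum) auto
    finally have "epowr (ennreal (avg f C)) q \<le> ennreal (?k powr q) * (\<Sum>b\<in>UNIV. grid_max f b x)"
      by (simp add: mult_left_mono)
    then have "epowr (ennreal (avg f C) * indicator C x) q \<le> ennreal (?k powr q) * (\<Sum>b\<in>UNIV. grid_max f b x)"
      using True by simp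
    then show ?thesis by (simp only: max_op_term[OF f C])
  qed (use m in \<open>simp add: power_0_left\<close>)
qed

lemma measurable_cell: "(\<lambda>x. c * indicator (cell b Q) x :: ennreal) \<in> borel_measurable lebesgue"
  by (intro borel_measurable_times_ennreal borel_measurable_const borel_measurable_indicator cell_sets)

lemma borel_measurable_grid_max: "grid_max f b \<in> borel_measurable lebesgue"
proof -
  have "grid_max f b = (\<lambda>x. SUP Q. ennreal (avg f (cell_cube b Q) powr q) * indicator (cell b Q) x)"
    by (simp add: grid_max_def fun_eq_iff)
  also have "\<dots> \<in> borel_measurable lebesgue"
    by (rule borel_measurable_SUP[OF countableI_type measurable_cell])
  finally show ?thesis .
qed

lemma nn_integral_grid_max_le:
  assumes bound: "\<And>F. finite F \<Longrightarrow> (\<integral>\<^sup>+x. (SUP Q\<in>F. ennreal (avg f (cell_cube b Q) powr q) * indicator (cell b Q) x) * ennreal (v x) \<partial>lebesgue) \<le> K"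
  shows "(\<integral>\<^sup>+x. grid_max f b x * ennreal (v x) \<partial>lebesgue) \<le> K"
proof -
  note [measurable] = weight_measurable[OF weight_v]
  \<comment> \<open>Initial segments of an enumeration of the countable index type, increasing to
    the whole grid for monotone convergence.\<close>
  define F :: "nat \<Rightarrow> (int \<times> ('n \<Rightarrow> int)) set" where "F n = from_nat ` {..n}" for n
  define h where "h n x = (SUP Q\<in>F n. ennreal (avg f (cell_cube b Q) powr q) * indicator (cell b Q) x) * ennreal (v x)" for n x
  have UF: "(\<Union>n. F n) = UNIV"
    unfolding F_def using from_nat_to_nat by (metis (no_types, lifting) UNIV_eq_I UN_iff atMost_iff image_eqI order.refl UNIV_I)
  have "grid_max f b x * ennreal (v x) = (SUP n. h n x)" for x
  proof -
    have "grid_max f b x = (SUP n. SUP Q\<in>F n. ennreal (avg f (cell_cube b Q) powr q) * indicator (cell b Q) x)"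
      unfolding grid_max_def UF[symmetric] by (simp add: SUP_UNION)
    then show ?thesis by (simp add: h_def SUP_mult_right_ennreal)
  qed
  moreover have "incseq h"
    unfolding h_def F_def
    by (intro incseq_SucI le_funI mult_right_mono SUP_subset_mono image_mono order.refl) simp_all
  moreover have "h n \<in> borel_measurable lebesgue" for n
  proof -
    have "(\<lambda>x. SUP Q\<in>F n. ennreal (avg f (cell_cube b Q) powr q) * indicator (cell b Q) x) \<in> borel_measurable lebesgue"
      by (rule borel_measurable_SUP[OF _ measurable_cell]) (simp add: F_def)
    then show ?thesis
      unfolding h_def by (rule borel_measurable_times_ennreal) measurable
  qed
  ultimately have "(\<integral>\<^sup>+x. grid_max f b x * ennreal (v x) \<partial>lebesgue) = (SUP n. integral\<^sup>N lebesgue (h n))"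
    by (simp add: nn_integral_monotone_convergence_SUP)
  also have "\<dots> \<le> K"
    unfolding h_def by (intro SUP_least bound) (simp add: F_def)
  finally show ?thesis .
qed

text \<open>Besides \<open>K\<close> from a single laminar family, the constant contains 12^(n m q)
  for replacing cubes by cells and 2^n for the number of shifts.\<close>

lemma wnorm_max_op_le:
  assumes S: "S_const m \<alpha> P q \<omega> v \<le> ennreal S" "0 \<le> S"
    and B: "\<And>i. i \<in> {1..m} \<Longrightarrow> A_infty_const (\<sigma> i) \<le> ennreal B" "0 < B"
    and f: "\<And>i. i \<in> {1..m} \<Longrightarrow> f i \<in> Lp_space (P i) (\<omega> i)"
  defines "K \<equiv> q / p * B powr (q / p) * (\<Prod>i\<in>{1..m}. ((2 * P i / (P i - 1)) powr P i * 2) powr (q / P i))"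
  shows "wnorm q v (max_op m \<alpha> f)
    \<le> ennreal ((((12 ^ CARD('n)) ^ m) powr q * (2 ^ CARD('n) * K)) powr (1 / q)) * ennreal S * (\<Prod>i\<in>{1..m}. Lp_norm (P i) (\<omega> i) (f i))"
proof -
  note [measurable] = weight_measurable[OF weight_v] borel_measurable_grid_max
  define N where "N i = enn2real (\<integral>\<^sup>+x. ennreal (\<bar>f i x\<bar> powr P i) * ennreal (\<omega> i x) \<partial>lebesgue)" for i
  have N: "(\<integral>\<^sup>+x. ennreal (\<bar>f i x\<bar> powr P i) * ennreal (\<omega> i x) \<partial>lebesgue) = ennreal (N i)" if "i \<in> {1..m}" for i
    using f[OF that] by (simp add: N_def Lp_space_def)
  have N0: "0 \<le> N i" for i by (simp add: N_def)
  have Lp: "Lp_norm (P i) (\<omega> i) (f i) = ennreal (N i powr (1 / P i))" if "i \<in> {1..m}" for i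
    using N[OF that] N0 by (simp add: Lp_norm_def wnorm_def epowr_ennreal)
  have K0: "0 \<le> K" unfolding K_def using q_pos p_pos by (intro mult_nonneg_nonneg prod_nonneg) auto
  let ?k = "((12 ^ CARD('n)) ^ m) powr q :: real"
  have prodN: "0 \<le> (\<Prod>i\<in>{1..m}. N i powr (q / P i))" by (intro prod_nonneg) auto
  have main: "(\<integral>\<^sup>+x. epowr (max_op m \<alpha> f x) q * ennreal (v x) \<partial>lebesgue)
      \<le> ennreal (?k * (2 ^ CARD('n) * K) * S powr q * (\<Prod>i\<in>{1..m}. N i powr (q / P i)))"
  \<comment> \<open>Hoelder divided by the \<open>N i\<close>, so a vanishing norm is treated apart:
    that f_i is zero almost everywhere, and M_alpha f vanishes at every point.\<close>
  proof (cases "\<exists>i\<in>{1..m}. N i = 0")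
    case True
    then obtain i where i: "i \<in> {1..m}" "N i = 0" by auto
    have [measurable]: "f i \<in> borel_measurable lebesgue" using f[OF i(1)] by (simp add: Lp_space_def)
    have "(\<integral>\<^sup>+x. ennreal (\<bar>f i x\<bar> powr P i) * ennreal (\<omega> i x) \<partial>lebesgue) = 0" using N[OF i(1)] i(2) by simp
    then have "AE x in lebesgue. ennreal (\<bar>f i x\<bar> powr P i) * ennreal (\<omega> i x) = 0"
      using weight_measurable[OF weight_\<omega>[OF i(1)]] by (subst (asm) nn_integral_0_iff_AE) auto
    then have ae: "AE x in lebesgue. f i x = 0"
      using AE_\<sigma>[OF i(1)] by eventually_elim (auto simp: ennreal_eq_0_iff)
    have "(\<integral>\<^sup>+y\<in>C. ennreal \<bar>f i y\<bar> \<partial>lebesgue) = 0" for C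
    proof -
      have "(\<integral>\<^sup>+y\<in>C. ennreal \<bar>f i y\<bar> \<partial>lebesgue) = (\<integral>\<^sup>+y. 0 \<partial>(lebesgue :: (real ^ 'n) measure))"
        using ae by (intro nn_integral_cong_AE) (auto elim!: eventually_mono)
      then show ?thesis by simp
    qed
    then have avg0: "avg f C = 0" for C using i(1) by (auto simp: avg_def prod_zero_iff intro!: bexI[of _ i])
    then have "max_op m \<alpha> f x = 0" for x
    proof -
      have "max_op m \<alpha> f x \<le> 0"
        unfolding max_op_def
      proof (rule SUP_least)
        fix C :: "(real ^ 'n) set" assume "C \<in> cubes"
        from max_op_term[OF f this] avg0[of C]
        show "ennreal (measure lebesgue C powr (\<alpha> / real CARD('n))) *
            (\<Prod>i\<in>{1..m}. indicator C x / emeasure lebesgue C * (\<integral>\<^sup>+y\<in>C. ennreal \<bar>f i y\<bar> \<partial>lebesgue)) \<le> 0"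
          by (simp only: ennreal_0 mult_zero_left order.refl)
      qed
      then show ?thesis by simp
    qed
    then show ?thesis by simp
  next
    case False
    then have Npos: "\<And>i. i \<in> {1..m} \<Longrightarrow> 0 < N i" using N0 by (metis order.not_eq_order_implies_strict)
    let ?L = "ennreal (K * S powr q * (\<Prod>i\<in>{1..m}. N i powr (q / P i)))"
    have "(\<integral>\<^sup>+x. epowr (max_op m \<alpha> f x) q * ennreal (v x) \<partial>lebesgue)
        \<le> (\<integral>\<^sup>+x. (\<Sum>b\<in>UNIV. ennreal ?k * (grid_max f b x * ennreal (v x))) \<partial>lebesgue)"
    proof (rule nn_integral_mono)
      fix x
      have "epowr (max_op m \<alpha> f x) q * ennreal (v x) \<le> ennreal ?k * (\<Sum>b\<in>UNIV. grid_max f b x) * ennreal (v x)"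
        by (intro mult_right_mono epowr_max_op_le f) auto
      then show "epowr (max_op m \<alpha> f x) q * ennreal (v x) \<le> (\<Sum>b\<in>UNIV. ennreal ?k * (grid_max f b x * ennreal (v x)))"
        by (simp add: sum_distrib_left sum_distrib_right mult.assoc)
    qed
    also have "\<dots> = (\<Sum>b\<in>UNIV. ennreal ?k * (\<integral>\<^sup>+x. grid_max f b x * ennreal (v x) \<partial>lebesgue))"
      by (simp add: nn_integral_sum nn_integral_cmult)
    also have "\<dots> \<le> (\<Sum>b\<in>(UNIV :: ('n \<Rightarrow> bool) set). ennreal ?k * ?L)"
    proof (intro sum_mono mult_left_mono nn_integral_grid_max_le)
      fix b :: "'n \<Rightarrow> bool" and F :: "(int \<times> ('n \<Rightarrow> int)) set" assume "finite F"
      then show "(\<integral>\<^sup>+x. (SUP Q\<in>F. ennreal (avg f (cell_cube b Q) powr q) * indicator (cell b Q) x) * ennreal (v x) \<partial>lebesgue) \<le> ?L"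
        unfolding K_def
        by (intro finite_laminar_bound S B f Npos laminar_on_subset[OF laminar_cells] cell_sets
            cell_cube_in_cubes cell_subset_cube cell_cube_diff_null) (simp_all add: N)
    qed simp
    also have "\<dots> = ennreal (2 ^ CARD('n)) * (ennreal ?k * ?L)"
      by (simp add: card_fun flip: ennreal_power)
    also have "\<dots> = ennreal (2 ^ CARD('n) * (?k * (K * S powr q * (\<Prod>i\<in>{1..m}. N i powr (q / P i)))))"
      using K0 prodN by (simp only: ennreal_mult[symmetric] mult_nonneg_nonneg powr_ge_zero zero_le_power zero_le_numeral)
    finally show ?thesis by (simp add: mult_ac)
  qed
  have "wnorm q v (max_op m \<alpha> f) \<le> epowr (ennreal (?k * (2 ^ CARD('n) * K) * S powr q * (\<Prod>i\<in>{1..m}. N i powr (q / P i)))) (1 / q)"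
    unfolding wnorm_def using main q_pos by (intro epowr_mono) auto
  also have "\<dots> = ennreal ((?k * (2 ^ CARD('n) * K)) powr (1 / q) * S * (\<Prod>i\<in>{1..m}. N i powr (1 / P i)))"
    using K0 S(2) q_pos prodN by (simp add: epowr_ennreal powr_mult powr_powr prod_powr_powr)
  also have "\<dots> = ennreal ((?k * (2 ^ CARD('n) * K)) powr (1 / q)) * ennreal S * ennreal (\<Prod>i\<in>{1..m}. N i powr (1 / P i))"
    using S(2) by (simp add: ennreal_mult prod_nonneg)
  also have "ennreal (\<Prod>i\<in>{1..m}. N i powr (1 / P i)) = (\<Prod>i\<in>{1..m}. Lp_norm (P i) (\<omega> i) (f i))"
    using Lp by (subst prod_ennreal[symmetric]) (auto intro!: prod.cong)
  finally show ?thesis .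
qed

text \<open>Necessity: insert f_i = sigma_i chi_R. By sigma^P omega = sigma the p_i-th power of its
  norm is sigma_i(R), so the quotient in the testing constant appears with constant 1.\<close>

lemma S_const_le_bound:
  assumes K: "max_op_bound m \<alpha> P q \<omega> v K"
  shows "S_const m \<alpha> P q \<omega> v \<le> K"
  unfolding S_const_def Let_def
proof (rule SUP_least)
  fix R :: "(real ^ 'n) set" assume R: "R \<in> cubes"
  let ?f = "\<lambda>i y. \<sigma> i y * indicator R y"
  let ?D = "\<Prod>i\<in>{1..m}. epowr (weight_mass (\<sigma> i) R) (1 / P i)"
  have D: "?D = ennreal (\<Prod>i\<in>{1..m}. mass i R powr (1 / P i))"
  proof -
    have "?D = (\<Prod>i\<in>{1..m}. epowr (ennreal (mass i R)) (1 / P i))"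
      using mass_eq[OF _ R] by (intro prod.cong refl) simp
    then show ?thesis by (simp only: prod_epowr_ennreal[OF mass_nonneg])
  qed
  have "0 < (\<Prod>i\<in>{1..m}. mass i R powr (1 / P i))"
    using mass_pos[OF _ R] by (intro prod_pos) (auto simp: order.strict_iff_order)
  then have D0: "0 < ?D" unfolding D by (simp only: ennreal_less_zero_iff)
  have int: "(\<integral>\<^sup>+x. ennreal (\<bar>?f i x\<bar> powr P i) * ennreal (\<omega> i x) \<partial>lebesgue) = weight_mass (\<sigma> i) R" if i: "i \<in> {1..m}" for i
    unfolding weight_mass_def
  proof (rule nn_integral_cong_AE)
    show "AE x in lebesgue. ennreal (\<bar>?f i x\<bar> powr P i) * ennreal (\<omega> i x) = ennreal (\<sigma> i x) * indicator R x"
      using AE_\<sigma>[OF i]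
    proof eventually_elim
      case (elim x)
      then show ?case using dual_weight_identities(2)[OF P[OF i], of "\<omega> i" x]
        by (auto simp: indicator_def simp flip: ennreal_mult)
    qed
  qed
  have f: "?f i \<in> Lp_space (P i) (\<omega> i)" if i: "i \<in> {1..m}" for i
    using int[OF i] weight_mass_finite[OF weight_\<sigma>[OF i] R] weight_measurable[OF weight_\<sigma>[OF i]] cube_sets[OF R]
    by (simp add: Lp_space_def)
  have norm: "(\<Prod>i\<in>{1..m}. Lp_norm (P i) (\<omega> i) (?f i)) = ?D"
    using int by (intro prod.cong refl) (simp add: Lp_norm_def wnorm_def epowr_ennreal)
  have "epowr (\<integral>\<^sup>+x\<in>R. epowr (max_op m \<alpha> ?f x) q * ennreal (v x) \<partial>lebesgue) (1 / q) \<le> wnorm q v (max_op m \<alpha> ?f)"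
    unfolding wnorm_def using q_pos by (intro epowr_mono nn_integral_mono) (auto simp: indicator_def)
  also have "\<dots> \<le> K * (\<Prod>i\<in>{1..m}. Lp_norm (P i) (\<omega> i) (?f i))"
    by (rule K[unfolded max_op_bound_def, rule_format]) (rule f)
  finally show "epowr (\<integral>\<^sup>+x\<in>R. epowr (max_op m \<alpha> ?f x) q * ennreal (v x) \<partial>lebesgue) (1 / q) / ?D \<le> K"
    unfolding norm using D0 by (intro divide_le_posI_ennreal) (simp_all add: mult.commute)
qed

end

section \<open>The two-weight characterisation\<close>

text \<open>Both constants are fixed before the weights: the lower estimate holds with c = 1, and
  the upper one sees the weights only through a common bound \<open>A\<close> for the A_infinity
  constants.\<close>

theorem corollary1p6:
  fixes m :: nat and \<alpha> p q :: real and P :: "nat \<Rightarrow> real"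
  assumes "1 \<le> m"
    and "\<forall>i\<in>{1..m}. 1 < P i"
    and "0 \<le> \<alpha>" and "\<alpha> < real m * real CARD('n)"
    and "1 / p = (\<Sum>i\<in>{1..m}. 1 / P i)"
    and "p \<le> q"
  shows "\<exists>(c::real) (C :: real \<Rightarrow> real). 0 < c \<and> (\<forall>A. 0 < C A) \<and>
    (\<forall>(\<omega> :: nat \<Rightarrow> real ^ 'n \<Rightarrow> real) (v :: real ^ 'n \<Rightarrow> real).
       (\<forall>i\<in>{1..m}. weight (\<omega> i)) \<and> weight v \<and>
       (\<forall>i\<in>{1..m}. dual_weight (P i) (\<omega> i) \<in> A_infty) \<longrightarrow>
         (max_op_bounded m \<alpha> P q \<omega> v \<longleftrightarrow> S_const m \<alpha> P q \<omega> v < \<infinity>) \<and>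
         S_const m \<alpha> P q \<omega> v \<le> ennreal c * max_op_norm m \<alpha> P q \<omega> v \<and>
         (\<forall>A. (\<forall>i\<in>{1..m}. A_infty_const (dual_weight (P i) (\<omega> i)) \<le> ennreal A) \<longrightarrow>
            max_op_norm m \<alpha> P q \<omega> v \<le> ennreal (C A) * S_const m \<alpha> P q \<omega> v))"
proof -
  define K where "K B = q / p * B powr (q / p) * (\<Prod>i\<in>{1..m}. ((2 * P i / (P i - 1)) powr P i * 2) powr (q / P i))" for B
  \<comment> \<open>The bound handed to the estimate must be positive, and \<open>C A\<close> must
    be positive for every real \<open>A\<close>, even a negative one; hence |A| + 1.\<close>
  define C where "C A = (((12 ^ CARD('n)) ^ m) powr q * (2 ^ CARD('n) * K (\<bar>A\<bar> + 1))) powr (1 / q)" for A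
  have "0 < 1 / p"
    unfolding assms(5) using assms(1,2) by (intro sum_pos) (force simp: less_trans[OF zero_less_one])+
  then have pq: "0 < p" "0 < q" using assms(6) by auto
  have "0 < K (\<bar>A\<bar> + 1)" for A
    unfolding K_def using pq assms(2) by (intro mult_pos_pos prod_pos) force+
  then have C: "0 < C A" for A
    unfolding C_def by (metis mult_pos_pos powr_gt_zero zero_less_numeral zero_less_power less_irrefl)
  show ?thesis
  proof (rule exI[of _ 1], rule exI[of _ C], intro conjI allI impI zero_less_one C)
    fix \<omega> :: "nat \<Rightarrow> real ^ 'n \<Rightarrow> real" and v :: "real ^ 'n \<Rightarrow> real"
    assume weights: "(\<forall>i\<in>{1..m}. weight (\<omega> i)) \<and> weight v \<and> (\<forall>i\<in>{1..m}. dual_weight (P i) (\<omega> i) \<in> A_infty)"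
    interpret maximal_setting m \<alpha> p q P \<omega> v
    proof unfold_locales
      show "1 / p = (\<Sum>i\<in>{1..m}. 1 / P i)" by (rule assms)
    qed (use assms(1-3,6) weights in \<open>simp_all add: A_infty_def\<close>)
    have bound: "max_op_bound m \<alpha> P q \<omega> v (ennreal (C A) * S_const m \<alpha> P q \<omega> v)"
      if A: "\<forall>i\<in>{1..m}. A_infty_const (\<sigma> i) \<le> ennreal A" and fin: "S_const m \<alpha> P q \<omega> v < \<infinity>" for A
    proof -
      obtain S where S: "S_const m \<alpha> P q \<omega> v = ennreal S" "0 \<le> S"
        using fin by (cases "S_const m \<alpha> P q \<omega> v") auto
      have "A_infty_const (\<sigma> i) \<le> ennreal (\<bar>A\<bar> + 1)" if "i \<in> {1..m}" for i
        using A that by (meson order.trans ennreal_leI abs_ge_self le_add_same_cancel1 zero_le_one)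
      then show ?thesis
        unfolding max_op_bound_def S(1) C_def K_def using S
        by (intro allI impI wnorm_max_op_le) auto
    qed
    have lower: "S_const m \<alpha> P q \<omega> v \<le> max_op_norm m \<alpha> P q \<omega> v"
      unfolding max_op_norm_def using S_const_le_bound by (intro Inf_greatest) auto
    then show "S_const m \<alpha> P q \<omega> v \<le> ennreal 1 * max_op_norm m \<alpha> P q \<omega> v" by simp
    show "max_op_bounded m \<alpha> P q \<omega> v \<longleftrightarrow> S_const m \<alpha> P q \<omega> v < \<infinity>"
    proof
      assume "max_op_bounded m \<alpha> P q \<omega> v"
      then show "S_const m \<alpha> P q \<omega> v < \<infinity>"
        unfolding max_op_bounded_def using S_const_le_bound le_less_trans by blast
    next
      assume fin: "S_const m \<alpha> P q \<omega> v < \<infinity>"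
      \<comment> \<open>The sum of the finitely many finite A_infinity constants serves as a common
        bound.\<close>
      define A where "A = (\<Sum>i\<in>{1..m}. enn2real (A_infty_const (\<sigma> i)))"
      have "A_infty_const (\<sigma> i) \<le> ennreal A" if "i \<in> {1..m}" for i
      proof -
        have "A_infty_const (\<sigma> i) = ennreal (enn2real (A_infty_const (\<sigma> i)))"
          using weights that by (simp add: A_infty_def)
        also have "\<dots> \<le> ennreal A"
          unfolding A_def using that by (intro ennreal_leI member_le_sum) auto
        finally show ?thesis .
      qed
      moreover have "ennreal (C A) * S_const m \<alpha> P q \<omega> v < \<infinity>"
        using fin by (simp add: ennreal_mult_less_top)
      ultimately show "max_op_bounded m \<alpha> P q \<omega> v"
        unfolding max_op_bounded_def using bound[OF _ fin] by blast
    qed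
    fix A assume A: "\<forall>i\<in>{1..m}. A_infty_const (\<sigma> i) \<le> ennreal A"
    show "max_op_norm m \<alpha> P q \<omega> v \<le> ennreal (C A) * S_const m \<alpha> P q \<omega> v"
    proof (cases "S_const m \<alpha> P q \<omega> v < \<infinity>")
      case True
      then show ?thesis unfolding max_op_norm_def using bound[OF A] by (intro Inf_lower) simp
    next
      case False
      \<comment> \<open>When the testing constant is infinite the right side is infinite too, since
        \<open>C A\<close> is not zero.\<close>
      moreover have "ennreal (C A) \<noteq> 0" using C[of A] by (simp add: ennreal_eq_0_iff not_le)
      ultimately show ?thesis by (simp add: ennreal_mult_top less_top[symmetric])
    qed
  qed
qed

end
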